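(* Let $n\ge2$ and $p\in(1,n]$. Suppose that $E\subset\mathbb{R}^n$ is $p$-thin for the singular behavior at the origin, and that the origin belongs to $\bar E\setminus E$. (i) If $p\in(1,n)$, then there is a nonnegative Radon measure $\mu$ in a neighborhood of the origin such that, for some fixed $r_0>0$, $$\lim_{x\to0,\ x\in E}|x|^{\frac{n-p}{p-1}}\,W^{\mu}_{1,p}(x,r_0)=\infty.$$ (ii) If $p=n$, then there is a nonnegative Radon measure $\mu$ in a neighborhood of the origin such that, for some fixed $r_0>0$, $$\lim_{x\to0,\ x\in E}\frac{W^{\mu}_{1,n}(x,r_0)}{\log\frac1{|x|}}=\infty.$$
   Context: Wolff potential: for a nonnegative Radon measure $\mu$ and $p\in(1,n]$, $$W^{\mu}_{1,p}(x,r)=\int_0^r\left(\frac{\mu(B(x,t))}{t^{n-p}}\right)^{\frac1{p-1}}\frac{dt}{t}.$$ $p$-capacity: for a compact subset $K$ of a domain $\Omega\subset\mathbb{R}^n$, $$cap_p(K,\Omega)=\inf\left\{\int_\Omega|\nabla u|^p\,dx:\ u\in C_0^\infty(\Omega),\ u\ge1\text{ on }K\right\},$$ and for an arbitrary subset $E\subset\Omega$, $$cap_p(E,\Omega)=\inf_{E\subset G\subset\Omega,\ G\text{ open}}\ \sup_{K\subset G,\ K\text{ compact}}cap_p(K,\Omega).$$ Thinness for the singular behavior: for $x_0\in\mathbb{R}^n$ put $$\omega_i(x_0)=\{x:2^{-i-1}\le|x-x_0|\le2^{-i}\},\qquad \Omega_i(x_0)=\{x:2^{-i-2}\le|x-x_0|\le2^{-i+1}\}$$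 (capacities relative to $\Omega_i(x_0)$ are understood relative to its interior). For $p\in(1,n)$, a set $E\subset\mathbb{R}^n$ is $p$-thin for the singular behavior at $x_0$ if $$\sum_{i=1}^\infty\frac{cap_p(E\cap\omega_i(x_0),\Omega_i(x_0))}{cap_p(\partial B(x_0,2^{-i}),B(x_0,2^{-i+1}))}<+\infty.$$ A set $E$ is $n$-thin for the singular behavior at $x_0$ if $$\sum_{i=1}^\infty i^{n-1}\,cap_n(E\cap\omega_i(x_0),\Omega_i(x_0))<+\infty.$$ *)

theory Defs
  imports "HOL-Analysis.Analysis"
begin

section \<open>Smooth functions with compact support\<close>

text \<open>\<open>Ck k u\<close>: the function \<open>u\<close> is \<open>k\<close> times continuously differentiable on the whole space.\<close>

primrec Ck :: "nat \<Rightarrow> ('a::euclidean_space \<Rightarrow> real) \<Rightarrow> bool" where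
  "Ck 0 u \<longleftrightarrow> continuous_on UNIV u"
| "Ck (Suc k) u \<longleftrightarrow>
     (\<forall>x. u differentiable at x) \<and> (\<forall>v. Ck k (\<lambda>x. frechet_derivative u (at x) v))"

text \<open>Elements of \<open>C\<^sub>0\<^sup>\<infinity>(\<Omega>)\<close> are represented by their extension by zero to the whole space.\<close>

definition test_function :: "'a::euclidean_space set \<Rightarrow> ('a \<Rightarrow> real) \<Rightarrow> bool" where
  "test_function \<Omega> u \<longleftrightarrow>
     (\<forall>k. Ck k u) \<and> compact (closure {x. u x \<noteq> 0}) \<and> closure {x. u x \<noteq> 0} \<subseteq> \<Omega>"

definition grad :: "('a::euclidean_space \<Rightarrow> real) \<Rightarrow> 'a \<Rightarrow> 'a" where
  "grad u x = (THE D. GDERIV u x :> D)"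


section \<open>Capacity\<close>

definition cap_compact :: "real \<Rightarrow> 'a::euclidean_space set \<Rightarrow> 'a set \<Rightarrow> ennreal" where
  "cap_compact p K \<Omega> =
     (INF u \<in> {u. test_function \<Omega> u \<and> (\<forall>x\<in>K. 1 \<le> u x)}.
        \<integral>\<^sup>+ x\<in>\<Omega>. ennreal (norm (grad u x) powr p) \<partial>lborel)"

definition cap :: "real \<Rightarrow> 'a::euclidean_space set \<Rightarrow> 'a set \<Rightarrow> ennreal" where
  "cap p E \<Omega> =
     (INF G \<in> {G. open G \<and> E \<subseteq> G \<and> G \<subseteq> \<Omega>}.
        SUP K \<in> {K. compact K \<and> K \<subseteq> G}. cap_compact p K \<Omega>)"

lemma GDERIV_unique:
  assumes "GDERIV u x :> D" "GDERIV u x :> D'"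
  shows "D = D'"
proof -
  have "(\<lambda>h. inner h D) = (\<lambda>h. inner h D')"
    using assms unfolding gderiv_def by (rule has_derivative_unique)
  then have "inner h D = inner h D'" for h
    by (rule fun_cong)
  from this[of "D - D'"] have "inner (D - D') (D - D') = 0"
    by (simp add: inner_diff_right)
  then show ?thesis
    by simp
qed

lemma GDERIV_grad:
  assumes "u differentiable at x"
  shows "GDERIV u x :> grad u x"
proof -
  let ?f = "frechet_derivative u (at x)"
  let ?D = "\<Sum>b\<in>Basis. ?f b *\<^sub>R b"
  have der: "(u has_derivative ?f) (at x)"
    by (rule frechet_derivative_works[THEN iffD1, OF assms])
  then have lin: "linear ?f"
    by (rule has_derivative_linear)
  have "?f h = inner h ?D" for h
  proof -
    have "?f h = ?f (\<Sum>b\<in>Basis. (inner h b) *\<^sub>R b)"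
      by (simp add: euclidean_representation)
    also have "\<dots> = (\<Sum>b\<in>Basis. inner h b * ?f b)"
      using lin by (simp add: linear_sum linear_cmul)
    also have "\<dots> = inner h ?D"
      by (simp add: inner_sum_right mult.commute)
    finally show ?thesis .
  qed
  then have "GDERIV u x :> ?D"
    unfolding gderiv_def by (intro has_derivative_eq_rhs[OF der] ext)
  then have "\<exists>D. GDERIV u x :> D"
    by (rule exI)
  then show ?thesis
    unfolding grad_def by (elim exE) (rule theI, assumption, rule GDERIV_unique)
qed

lemma Ck_differentiable: "Ck (Suc k) u \<Longrightarrow> u differentiable at x"
  by simp

lemma frechet_derivative_scale:
  fixes u :: "'a::euclidean_space \<Rightarrow> real"
  assumes "u differentiable at x"
  shows "frechet_derivative (\<lambda>y. s * u y) (at x) v = s * frechet_derivative u (at x) v"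
proof -
  have "(u has_derivative frechet_derivative u (at x)) (at x)"
    by (rule frechet_derivative_works[THEN iffD1, OF assms])
  then have "((\<lambda>y. s * u y) has_derivative (\<lambda>h. s * frechet_derivative u (at x) h)) (at x)"
    by (rule has_derivative_mult_right)
  then show ?thesis
    by (simp add: frechet_derivative_at[symmetric])
qed

lemma Ck_scale: "Ck k u \<Longrightarrow> Ck k (\<lambda>x. s * u x)"
proof (induction k arbitrary: u)
  case 0
  then show ?case by (auto intro: continuous_on_mult_left)
next
  case (Suc k)
  then have d: "\<And>x. u differentiable at x"
    by simp
  have "(\<lambda>y. s * u y) differentiable at x" for x
    using d by (simp add: differentiable_mult)
  moreover have "Ck k (\<lambda>x. s * frechet_derivative u (at x) v)" for v
    using Suc by simp
  ultimately show ?case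
    by (simp add: frechet_derivative_scale[OF d])
qed

lemma grad_scale:
  assumes "u differentiable at x"
  shows "grad (\<lambda>y. s * u y) x = s *\<^sub>R grad u x"
proof -
  have "GDERIV u x :> grad u x"
    using assms by (rule GDERIV_grad)
  then have "GDERIV (\<lambda>y. s * u y) x :> s *\<^sub>R grad u x"
    unfolding gderiv_def inner_scaleR_right by (rule has_derivative_mult_right)
  moreover from this have "(\<lambda>y. s * u y) differentiable at x"
    unfolding gderiv_def differentiable_def by blast
  ultimately show ?thesis
    by (intro GDERIV_unique[OF GDERIV_grad])
qed

lemma test_function_scale:
  assumes "test_function \<Omega> u" "s \<noteq> 0"
  shows "test_function \<Omega> (\<lambda>x. s * u x)"
  using assms by (simp add: test_function_def Ck_scale)

text \<open>On compact sets the two definitions agree, so \<open>cap\<close> is used for all sets.\<close>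

lemma cap_eq_cap_compact:
  fixes K :: "'a::euclidean_space set"
  assumes "compact K" "open \<Omega>" "K \<subseteq> \<Omega>" "0 < p"
  shows "cap p K \<Omega> = cap_compact p K \<Omega>"
proof (rule antisym)
  show "cap_compact p K \<Omega> \<le> cap p K \<Omega>"
    unfolding cap_def using assms by (intro INF_greatest SUP_upper) auto
  show "cap p K \<Omega> \<le> cap_compact p K \<Omega>"
    unfolding cap_compact_def[of p K]
  proof (rule INF_greatest)
    fix u assume "u \<in> {u. test_function \<Omega> u \<and> (\<forall>x\<in>K. 1 \<le> u x)}"
    then have u: "test_function \<Omega> u" "\<And>x. x \<in> K \<Longrightarrow> 1 \<le> u x"
      by auto
    have d: "u differentiable at x" for x
      using u(1) Ck_differentiable unfolding test_function_def by blast
    define c where "c = (\<integral>\<^sup>+ x\<in>\<Omega>. ennreal (norm (grad u x) powr p) \<partial>lborel)"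
    have scaled: "cap p K \<Omega> \<le> ennreal (s powr p) * c" if s: "s > 1" for s
    proof -
      define G where "G = \<Omega> \<inter> {x. 1 < s * u x}"
      have "continuous_on UNIV u"
        using u(1) unfolding test_function_def by (metis Ck.simps(1))
      then have "open {x. 1 < s * u x}"
        by (intro open_Collect_less continuous_intros)
      then have "open G"
        unfolding G_def using assms by auto
      have "1 < s * u x" if "x \<in> K" for x
        using mult_left_mono[of 1 "u x" s] u(2)[OF that] s by linarith
      then have "K \<subseteq> G"
        unfolding G_def using assms by auto
      have "cap_compact p K' \<Omega> \<le> ennreal (s powr p) * c" if "K' \<subseteq> G" for K'
      proof -
        have "cap_compact p K' \<Omega> \<le>
            (\<integral>\<^sup>+ x\<in>\<Omega>. ennreal (norm (grad (\<lambda>y. s * u y) x) powr p) \<partial>lborel)"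
          unfolding cap_compact_def
          using test_function_scale[OF u(1)] s that
          by (intro INF_lower) (auto simp: G_def intro: less_imp_le)
        also have "\<dots> = (\<integral>\<^sup>+ x. ennreal (s powr p) *
            (ennreal (norm (grad u x) powr p) * indicator \<Omega> x) \<partial>lborel)"
          using s by (intro nn_integral_cong)
            (simp add: grad_scale[OF d] powr_mult ennreal_mult mult.assoc)
        also have "\<dots> = ennreal (s powr p) * c"
          unfolding c_def
        proof (rule nn_integral_cmult)
          have g: "norm (grad u x) = sqrt (\<Sum>b\<in>Basis. (frechet_derivative u (at x) b)\<^sup>2)" for x
          proof -
            have "GDERIV u x :> grad u x"
              using d by (rule GDERIV_grad)
            then have "frechet_derivative u (at x) = (\<lambda>h. inner h (grad u x))"
              unfolding gderiv_def by (metis frechet_derivative_at)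
            then show ?thesis
              by (simp add: norm_eq_sqrt_inner euclidean_inner[of "grad u x" "grad u x"]
                  power2_eq_square inner_commute)
          qed
          have "continuous_on UNIV (\<lambda>x. frechet_derivative u (at x) b)" for b
            using u(1) unfolding test_function_def
            by (metis Ck.simps(1) Ck.simps(2))
          then have [measurable]: "(\<lambda>x. frechet_derivative u (at x) b) \<in> borel_measurable borel" for b
            by (rule borel_measurable_continuous_onI)
          have [measurable]: "\<Omega> \<in> sets borel"
            using assms by auto
          show "(\<lambda>x. ennreal (norm (grad u x) powr p) * indicator \<Omega> x) \<in> borel_measurable lborel"
            unfolding g by measurable
        qed
        finally show ?thesis .
      qed
      then have "(SUP K' \<in> {K'. compact K' \<and> K' \<subseteq> G}. cap_compact p K' \<Omega>) \<le> ennreal (s powr p) * c"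
        by (intro SUP_least) auto
      moreover have "cap p K \<Omega> \<le> (SUP K' \<in> {K'. compact K' \<and> K' \<subseteq> G}. cap_compact p K' \<Omega>)"
        unfolding cap_def using \<open>open G\<close> \<open>K \<subseteq> G\<close> by (intro INF_lower) (auto simp: G_def)
      ultimately show ?thesis
        by (rule order_trans[rotated])
    qed
    have "((\<lambda>s. ennreal (s powr p)) \<longlongrightarrow> ennreal (1 powr p)) (at_right 1)"
      by (intro tendsto_ennrealI tendsto_intros) auto
    then have "((\<lambda>s. c * ennreal (s powr p)) \<longlongrightarrow> c * ennreal (1 powr p)) (at_right 1)"
      by (intro ennreal_tendsto_cmult tendsto_mult_ennreal tendsto_const) auto
    then have lim: "((\<lambda>s. ennreal (s powr p) * c) \<longlongrightarrow> c) (at_right 1)"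
      by (simp add: mult.commute)
    have "\<forall>\<^sub>F s in at_right (1::real). cap p K \<Omega> \<le> ennreal (s powr p) * c"
      using scaled by (auto simp: eventually_at_right_field intro: exI[of _ 2])
    then have "cap p K \<Omega> \<le> c"
      by (intro tendsto_lowerbound[OF lim]) auto
    then show "cap p K \<Omega> \<le> (\<integral>\<^sup>+ x\<in>\<Omega>. ennreal (norm (grad u x) powr p) \<partial>lborel)"
      unfolding c_def .
  qed
qed


section \<open>Thinness for the singular behavior\<close>

definition annulus_in :: "'a::euclidean_space \<Rightarrow> nat \<Rightarrow> 'a set" where
  "annulus_in x0 i = {x. 2 powi (- int i - 1) \<le> norm (x - x0) \<and> norm (x - x0) \<le> 2 powi (- int i)}"

definition annulus_out :: "'a::euclidean_space \<Rightarrow> nat \<Rightarrow> 'a set" where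
  "annulus_out x0 i = {x. 2 powi (- int i - 2) \<le> norm (x - x0) \<and> norm (x - x0) \<le> 2 powi (- int i + 1)}"

text \<open>
  The exponent is meant to satisfy \<open>1 < p \<le> DIM('a)\<close>, so the second branch is the case
  \<open>p = DIM('a)\<close>. The sums run over \<open>i \<ge> 1\<close>, hence the shift by \<open>Suc\<close>.
\<close>

definition thin_singular :: "real \<Rightarrow> 'a::euclidean_space set \<Rightarrow> 'a \<Rightarrow> bool" where
  "thin_singular p E x0 \<longleftrightarrow>
     (if p < real DIM('a) then
        (\<Sum>j. let i = Suc j in
           cap p (E \<inter> annulus_in x0 i) (interior (annulus_out x0 i)) /
           cap p (sphere x0 (2 powi (- int i))) (ball x0 (2 powi (- int i + 1)))) < \<infinity>
      else
        (\<Sum>j. let i = Suc j in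
           of_nat (i ^ (DIM('a) - 1)) *
           cap p (E \<inter> annulus_in x0 i) (interior (annulus_out x0 i))) < \<infinity>)"


section \<open>Radon measures and the Wolff potential\<close>

text \<open>
  A Radon measure on the open set \<open>U\<close> is a measure on the Borel sets of \<open>U\<close> that is
  finite on compact subsets of \<open>U\<close> and inner regular.
\<close>

definition radon_measure_on :: "'a::euclidean_space set \<Rightarrow> 'a measure \<Rightarrow> bool" where
  "radon_measure_on U \<mu> \<longleftrightarrow>
     sets \<mu> = sets (restrict_space borel U) \<and>
     (\<forall>K. compact K \<and> K \<subseteq> U \<longrightarrow> emeasure \<mu> K < \<infinity>) \<and>
     (\<forall>A\<in>sets \<mu>. emeasure \<mu> A = (SUP K \<in> {K. compact K \<and> K \<subseteq> A}. emeasure \<mu> K))"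

text \<open>Powers with exponent \<open>s > 0\<close>.\<close>

definition ennreal_powr :: "ennreal \<Rightarrow> real \<Rightarrow> ennreal" where
  "ennreal_powr a s = (if a = \<infinity> then \<infinity> else ennreal (enn2real a powr s))"

text \<open>
  Since \<open>emeasure\<close> vanishes on non-measurable sets, this is meaningful for a measure on \<open>U\<close>
  only if \<open>ball x t \<subseteq> U\<close> for all \<open>t < r\<close>.
\<close>

definition wolff :: "'a::euclidean_space measure \<Rightarrow> real \<Rightarrow> 'a \<Rightarrow> real \<Rightarrow> ennreal" where
  "wolff \<mu> p x r =
     (\<integral>\<^sup>+ t\<in>{0<..<r}.
        ennreal_powr (emeasure \<mu> (ball x t) / ennreal (t powr (real DIM('a) - p))) (1 / (p - 1))
          / ennreal t \<partial>lborel)"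

end

theory Submission
  imports Defs "HOL-Probability.Infinite_Product_Measure" "HOL-Probability.Probability_Mass_Function"
begin

text \<open>
  Suppose that for each annulus \<open>\<omega>\<^sub>i\<close> there is a measure \<open>\<mu>\<^sub>i\<close> of mass at most a constant times the
  capacity of \<open>E \<inter> \<omega>\<^sub>i\<close> (plus a summable error) whose Wolff potential is bounded below by a fixed
  positive constant on all of \<open>E \<inter> \<omega>\<^sub>i\<close>. Multiplying a measure by \<open>c\<close> multiplies its Wolff
  potential by \<open>c\<^bsup>1/(p-1)\<^esup>\<close>. Thinness implies that the capacities are summable with weights \<open>q\<^sub>i\<close>,
  where \<open>q\<^sub>i = 2\<^bsup>i(n-p)\<^esup>\<close> if \<open>p < n\<close> (the capacity of the sphere of radius \<open>2\<^bsup>-i\<^esup>\<close> is at most a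
  multiple of \<open>1 / q\<^sub>i\<close>) and \<open>q\<^sub>i = i\<^bsup>n-1\<^esup>\<close> if \<open>p = n\<close>; and up to a constant factor \<open>q\<^sub>i\<^bsup>1/(p-1)\<^esup>\<close> is
  the growth that the normalising factor of the theorem removes. A convergent series remains convergent after
  multiplication by suitable \<open>\<gamma>\<^sub>i \<rightarrow> \<infinity>\<close>, so that \<open>\<Sum>\<^sub>i q\<^sub>i \<gamma>\<^sub>i \<mu>\<^sub>i\<close> is a finite measure with the
  required limit.

  The measures \<open>\<mu>\<^sub>i\<close> come from a nonlinear electrical network, which replaces the potential theory
  of the \<open>p\<close>-Laplacian. Let \<open>G\<close> be an open set containing \<open>E \<inter> \<omega>\<^sub>i\<close> that almost realises its
  capacity. Subdivide a large cube dyadically and stop at the cubes contained in \<open>G\<close>, the leaves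
  of the tree. A cube \<open>Q\<close> of side \<open>l\<close> is given the conductance \<open>l\<^bsup>n-p\<^esup>\<close>, conductances in parallel
  are added, and in series the powers \<open>c\<^bsup>-1/(p-1)\<^esup>\<close> are added. Two facts carry the proof.

  First, the conductance between the root and the leaves is at most a multiple of the capacity
  (\<open>cond_le_capacity\<close>). Let \<open>u\<close> be admissible for the capacity, and let \<open>f\<close> be the norm of its
  gradient. The mean of \<open>u\<close> changes from a cube to a child by at most a multiple of \<open>l\<close> times the
  mean of \<open>f\<close>. Using these increments as voltages would count the same gradient at every scale.
  Summation by parts along a branch allows them to be replaced by \<open>l\<close> times the increments of the
  running maximum of the means of \<open>f\<close>, and the energy of those is bounded by \<open>\<integral> f\<^bsup>p\<^esup>\<close> through
  Doob's maximal inequality. One induction with a Bellman function does both.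

  Second, the equilibrium flow \<open>m\<close> from the root to the leaves satisfies
  \<open>\<Sum> (m(Q) / l(Q)\<^bsup>n-p\<^esup>)\<^bsup>1/(p-1)\<^esup> = 1\<close>, where the sum runs over the cubes of a branch that ends in a
  leaf (\<open>potential_leaf\<close>). For a measure that gives every cube \<open>Q\<close> at least the mass \<open>m(Q)\<close> this
  sum is, up to a factor, a lower bound for the Wolff potential at the points of the leaf
  (\<open>wolff_ge_on_leaves\<close>). Part of the flow can escape along infinite branches, towards the boundary
  of \<open>G\<close>; the measure is therefore defined as the law of the limit point of a random descent that
  follows the flow (\<open>ex_equilibrium_measure\<close>).
\<close>

section \<open>Inequalities for powers\<close>

lemma young_powr:
  fixes y z p :: real
  assumes "1 < p" "0 \<le> y" "0 \<le> z"
  shows "p * z powr (p - 1) * y \<le> (p - 1) * z powr p + y powr p"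
proof -
  define q where "q = p / (p - 1)"
  have q: "1 < q" "1 / p + 1 / q = 1" "(p - 1) * q = p"
    using assms by (auto simp: q_def field_simps)
  have "y * z powr (p - 1) \<le> y powr p / p + (z powr (p - 1)) powr q / q"
    by (rule Youngs_inequality) (use assms q in auto)
  also have "(z powr (p - 1)) powr q = z powr p"
    using q by (simp add: powr_powr)
  finally have "p * (y * z powr (p - 1)) \<le> p * (y powr p / p + z powr p / q)"
    using assms by (intro mult_left_mono) auto
  also have "\<dots> = (p - 1) * z powr p + y powr p"
    using assms by (simp add: q_def field_simps)
  finally show ?thesis by (simp add: mult_ac)
qed

text \<open>
  Convexity including the end point \<open>0\<close>: the tangent at the mean lies below the graph, which is
  what \<open>young_powr\<close> says.
\<close>

lemma powr_convex_combination:
  fixes a b x y p :: real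
  assumes "1 < p" "0 \<le> a" "0 \<le> b" "a + b = 1" "0 \<le> x" "0 \<le> y"
  shows "(a * x + b * y) powr p \<le> a * x powr p + b * y powr p"
proof -
  define m where "m = a * x + b * y"
  have m: "0 \<le> m" using assms by (simp add: m_def)
  have mm: "m powr p = m powr (p - 1) * m"
    using m powr_mult_base[of m "p - 1"] by (simp add: mult.commute)
  have "a * (p * m powr (p - 1) * x) + b * (p * m powr (p - 1) * y)
      \<le> a * ((p - 1) * m powr p + x powr p) + b * ((p - 1) * m powr p + y powr p)"
    using assms m by (intro add_mono mult_left_mono young_powr) auto
  also have "\<dots> = (a + b) * ((p - 1) * m powr p) + a * x powr p + b * y powr p"
    by (simp add: algebra_simps)
  also have "a * (p * m powr (p - 1) * x) + b * (p * m powr (p - 1) * y) = p * m powr p"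
    unfolding mm by (subst (3) m_def) (simp add: algebra_simps)
  finally show ?thesis
    using assms by (simp add: m_def[symmetric] algebra_simps)
qed

lemma young_powr_half:
  fixes y z p :: real
  assumes "1 < p" "0 \<le> y" "0 \<le> z"
  shows "p * z powr (p - 1) * y
    \<le> (p - 1) / 2 * z powr p + p * (2 * p / (p - 1)) powr (p - 1) * y powr p"
proof (cases "2 * p * y \<le> (p - 1) * z")
  case True
  have zz: "z powr p = z powr (p - 1) * z"
    using assms powr_mult_base[of z "p - 1"] by (simp add: mult.commute)
  have "z powr (p - 1) * (2 * p * y) \<le> z powr (p - 1) * ((p - 1) * z)"
    by (intro mult_left_mono True) auto
  then have "p * z powr (p - 1) * y \<le> (p - 1) / 2 * z powr p"
    by (simp add: zz algebra_simps)
  then show ?thesis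
    using assms by (smt (verit) mult_nonneg_nonneg powr_ge_zero)
next
  case False
  have yy: "y powr p = y powr (p - 1) * y"
    using assms powr_mult_base[of y "p - 1"] by (simp add: mult.commute)
  have "z \<le> 2 * p / (p - 1) * y"
    using False assms by (simp add: field_simps)
  then have "z powr (p - 1) \<le> (2 * p / (p - 1) * y) powr (p - 1)"
    using assms by (intro powr_mono2) auto
  also have "\<dots> = (2 * p / (p - 1)) powr (p - 1) * y powr (p - 1)"
    by (rule powr_mult)
  finally have "p * y * z powr (p - 1) \<le> p * y * ((2 * p / (p - 1)) powr (p - 1) * y powr (p - 1))"
    using assms by (intro mult_left_mono) auto
  then have "p * z powr (p - 1) * y \<le> p * (2 * p / (p - 1)) powr (p - 1) * y powr p"
    by (simp add: yy mult_ac)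
  moreover have "0 \<le> (p - 1) / 2 * z powr p"
    using assms by simp
  ultimately show ?thesis by linarith
qed

lemma powr_diff_le:
  fixes a b p :: real
  assumes "1 \<le> p" "0 \<le> b" "b \<le> a"
  shows "(a - b) powr p \<le> a powr p - b powr p"
proof -
  have sp: "t powr p = t powr (p - 1) * t" if "0 \<le> t" for t :: real
    using that powr_mult_base[of t "p - 1"] by (simp add: mult.commute)
  have "(a - b) powr (p - 1) * (a - b) \<le> a powr (p - 1) * (a - b)"
    using assms by (intro mult_right_mono powr_mono2) auto
  moreover have "b powr (p - 1) * b \<le> a powr (p - 1) * b"
    using assms by (intro mult_right_mono powr_mono2) auto
  ultimately show ?thesis
    using assms by (simp add: sp algebra_simps)
qed

section \<open>Nonlinear conductances in series\<close>

text \<open>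
  The case \<open>c \<le> 0\<close> is an interrupted circuit; at \<open>c = 0\<close> the formula would treat it as a perfect conductor,
  since negative powers of \<open>0\<close> have the value \<open>0\<close>.
\<close>

definition series_cond :: "real \<Rightarrow> real \<Rightarrow> real \<Rightarrow> real" where
  "series_cond p w c =
     (if c \<le> 0 then 0
      else (w powr (- 1 / (p - 1)) + c powr (- 1 / (p - 1))) powr (- (p - 1)))"

lemma series_cond_nonneg: "0 \<le> series_cond p w c"
  by (simp add: series_cond_def)

lemma series_cond_pos:
  assumes "0 < w" "0 < c"
  shows "0 < series_cond p w c"
proof -
  have "0 < w powr (- 1 / (p - 1)) + c powr (- 1 / (p - 1))"
    using assms by (intro add_pos_pos) auto
  then show ?thesis using assms by (simp add: series_cond_def)
qed

lemma resistance_powr: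
  fixes w p :: real
  assumes "1 < p" "0 < w"
  shows "(w powr (- 1 / (p - 1))) powr (- (p - 1)) = w"
proof -
  have "(- 1 / (p - 1)) * (- (p - 1)) = 1" using assms by (simp add: field_simps)
  then show ?thesis using assms by (simp only: powr_powr powr_one)
qed

lemma series_cond_le:
  assumes "1 < p" "0 < w"
  shows "series_cond p w c \<le> w"
proof (cases "c \<le> 0")
  case False
  have "series_cond p w c \<le> (w powr (- 1 / (p - 1))) powr (- (p - 1))"
    using False assms by (auto simp: series_cond_def intro!: powr_mono2')
  then show ?thesis using resistance_powr[OF assms] by simp
qed (use assms in \<open>auto simp: series_cond_def\<close>)

lemma series_cond_mono:
  assumes "1 < p" "0 < w" "c \<le> d"
  shows "series_cond p w c \<le> series_cond p w d"
proof (cases "c \<le> 0")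
  case False
  then have "d powr (- 1 / (p - 1)) \<le> c powr (- 1 / (p - 1))"
    using assms by (intro powr_mono2') auto
  then show ?thesis
    using False assms by (auto simp: series_cond_def intro!: powr_mono2' add_pos_pos)
qed (use series_cond_nonneg in \<open>auto simp: series_cond_def\<close>)

lemma series_cond_resistance:
  assumes "1 < p" "0 < w" "0 < c"
  shows "series_cond p w c powr (- 1 / (p - 1)) = w powr (- 1 / (p - 1)) + c powr (- 1 / (p - 1))"
proof -
  define R where "R = w powr (- 1 / (p - 1)) + c powr (- 1 / (p - 1))"
  have R: "0 < R" using assms unfolding R_def by (intro add_pos_pos) auto
  have "(- (p - 1)) * (- 1 / (p - 1)) = 1" using assms by (simp add: field_simps)
  then have "(R powr (- (p - 1))) powr (- 1 / (p - 1)) = R"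
    using R by (simp only: powr_powr powr_one)
  then show ?thesis using assms by (simp add: series_cond_def R_def)
qed

text \<open>
  The current through two conductors in series distributes the total voltage \<open>s + t\<close> so as to
  minimise the energy, and \<open>series_cond\<close> is the minimum for total voltage \<open>1\<close>. The inequality is
  Jensen's inequality for the weights proportional to the resistances.
\<close>

lemma series_cond_energy:
  assumes "1 < p" "0 < w" "0 \<le> c" "0 \<le> s" "0 \<le> t"
  shows "series_cond p w c * (s + t) powr p \<le> w * s powr p + c * t powr p"
proof (cases "c = 0")
  case True
  then show ?thesis using assms by (simp add: series_cond_def)
next
  case False
  with assms have c: "0 < c" by simp
  define R where "R = w powr (- 1 / (p - 1))"
  define S where "S = c powr (- 1 / (p - 1))"
  have pos: "0 < R" "0 < S" using assms c by (auto simp: R_def S_def)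
  define a where "a = R / (R + S)"
  define b where "b = S / (R + S)"
  have ab: "0 < a" "0 < b" "a + b = 1"
    using pos by (auto simp: a_def b_def add_divide_distrib[symmetric])
  have le: "(s + t) powr p \<le> a * (s / a) powr p + b * (t / b) powr p"
    using powr_convex_combination[of p a b "s / a" "t / b"] ab assms by simp
  define cc where "cc = series_cond p w c"
  have cc: "cc = (R + S) powr (- (p - 1))" "0 < cc"
    using c assms series_cond_pos[of w c p] by (auto simp: cc_def series_cond_def R_def S_def)
  have gen: "cc * (x * (u / x) powr p) = W * u powr p"
    if "x = T / (R + S)" "T = W powr (- 1 / (p - 1))" "0 < T" "0 < W" "0 \<le> u" for x T W u
  proof -
    have W: "W = T powr (- (p - 1))"
      using resistance_powr[of p W] that assms by simp
    have x: "0 < x" using that pos by auto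
    have "x * (u / x) powr p = x powr (- (p - 1)) * u powr p"
      using x \<open>0 \<le> u\<close> by (simp add: powr_divide powr_minus powr_diff field_simps)
    moreover have "x powr (- (p - 1)) = T powr (- (p - 1)) / (R + S) powr (- (p - 1))"
      using that pos by (simp add: powr_divide)
    ultimately show ?thesis
      using cc W pos by simp
  qed
  have "cc * (s + t) powr p \<le> cc * (a * (s / a) powr p + b * (t / b) powr p)"
    using le cc by (intro mult_left_mono) auto
  also have "\<dots> = w * s powr p + c * t powr p"
    using gen[of a R w s] gen[of b S c t] pos assms c
    by (simp add: a_def b_def R_def S_def distrib_left)
  finally show ?thesis by (simp add: cc_def)
qed

text \<open>
  At the limit \<open>0\<close> the formula for \<open>series_cond\<close> changes, but an increasing nonnegative sequence
  reaches this limit only if it is constantly \<open>0\<close>.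
\<close>

lemma tendsto_series_cond:
  assumes "1 < p" "0 < w" "incseq c" "c \<longlonglongrightarrow> d" "\<And>N. 0 \<le> c N"
  shows "(\<lambda>N. series_cond p w (c N)) \<longlonglongrightarrow> series_cond p w d"
proof (cases "d \<le> 0")
  case True
  have "c N \<le> 0" for N
    using incseq_le[OF assms(3,4), of N] True by simp
  then show ?thesis using True by (simp add: series_cond_def)
next
  case False
  then have "eventually (\<lambda>N. c N > 0) sequentially"
    using order_tendstoD(1)[OF assms(4), of 0] by simp
  then have "eventually (\<lambda>N. (w powr (- 1 / (p - 1)) + c N powr (- 1 / (p - 1))) powr (- (p - 1))
      = series_cond p w (c N)) sequentially"
    by eventually_elim (simp add: series_cond_def)
  moreover have "(\<lambda>N. (w powr (- 1 / (p - 1)) + c N powr (- 1 / (p - 1))) powr (- (p - 1)))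
      \<longlonglongrightarrow> (w powr (- 1 / (p - 1)) + d powr (- 1 / (p - 1))) powr (- (p - 1))"
    using False assms add_pos_pos[of "w powr (- 1 / (p - 1))" "d powr (- 1 / (p - 1))"]
    by (intro tendsto_intros assms) auto
  ultimately show ?thesis
    using False by (auto simp: series_cond_def intro: Lim_transform_eventually)
qed

section \<open>A Bellman function\<close>

text \<open>
  The constant in \<open>young_powr_half\<close>.
\<close>

definition young_const :: "real \<Rightarrow> real" where
  "young_const p = p * (2 * p / (p - 1)) powr (p - 1)"

text \<open>
  For a cube of volume \<open>vol\<close> on which \<open>f\<close> has integral \<open>J\<close> and \<open>f\<^bsup>p\<^esup>\<close> has integral \<open>P\<close>, this bounds
  the sum of \<open>vol Q' * (z(Q')\<^bsup>p\<^esup> - z(parent of Q')\<^bsup>p\<^esup>)\<close> over dyadic subcubes \<open>Q'\<close>, where \<open>z\<close> is the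
  running maximum of the means of \<open>f\<close> and has the value \<open>z\<close> above the cube. The expression
  \<open>(p - 1) z\<^bsup>p\<^esup> - p z\<^bsup>p-1\<^esup> y\<close> is the supermartingale in the proof of Doob's \<open>L\<^bsup>p\<^esup>\<close> inequality. As
  \<open>bellman\<close> is linear in \<open>vol\<close>, \<open>J\<close> and \<open>P\<close>, its values on the children of a cube add up to its
  value on the cube.
\<close>

definition bellman :: "real \<Rightarrow> real \<Rightarrow> real \<Rightarrow> real \<Rightarrow> real \<Rightarrow> real" where
  "bellman p vol J P z =
     2 / (p - 1) * ((p - 1) * z powr p * vol - p * z powr (p - 1) * J + young_const p * P)
       - z powr p * vol"

text \<open>
  When the running maximum rises from \<open>z\<close> to the mean \<open>y\<close>, convexity of the power makes the
  supermartingale decrease, and the last term of \<open>bellman\<close> absorbs the rise of \<open>z\<^bsup>p\<^esup>\<close>.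
\<close>

lemma bellman_step:
  fixes p vol y P z :: real
  assumes "1 < p" "0 < vol" "0 \<le> y" "0 \<le> z"
  shows "vol * (max z y powr p - z powr p) + bellman p vol (y * vol) P (max z y)
    \<le> bellman p vol (y * vol) P z"
proof (cases "y \<le> z")
  case True
  then show ?thesis by (simp add: max_def)
next
  case False
  then have m: "max z y = y" by simp
  have yy: "y powr p = y powr (p - 1) * y"
    using assms powr_mult_base[of y "p - 1"] by (simp add: mult.commute)
  have "2 / (p - 1) * vol * (p * z powr (p - 1) * y)
      \<le> 2 / (p - 1) * vol * ((p - 1) * z powr p + y powr p)"
    using assms by (intro mult_left_mono young_powr) auto
  then show ?thesis
    using assms by (simp add: m bellman_def algebra_simps yy)
qed

lemma bellman_nonneg:
  fixes p vol y P z :: real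
  assumes "1 < p" "0 < vol" "0 \<le> y" "0 \<le> z" "y powr p * vol \<le> P"
  shows "0 \<le> bellman p vol (y * vol) P z"
proof -
  have D: "0 \<le> young_const p" using assms by (simp add: young_const_def)
  have "p * z powr (p - 1) * y \<le> (p - 1) / 2 * z powr p + young_const p * y powr p"
    using young_powr_half[of p y z] assms by (simp add: young_const_def)
  then have "vol * (p * z powr (p - 1) * y)
      \<le> vol * ((p - 1) / 2 * z powr p + young_const p * y powr p)"
    using assms by (intro mult_left_mono) auto
  moreover have "young_const p * (y powr p * vol) \<le> young_const p * P"
    using assms D by (intro mult_left_mono) auto
  ultimately have "(p - 1) / 2 * (z powr p * vol)
      \<le> (p - 1) * z powr p * vol - p * z powr (p - 1) * (y * vol) + young_const p * P"
    by (simp add: field_simps)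
  then have "2 / (p - 1) * ((p - 1) / 2 * (z powr p * vol)) \<le> 2 / (p - 1) *
      ((p - 1) * z powr p * vol - p * z powr (p - 1) * (y * vol) + young_const p * P)"
    using assms by (intro mult_left_mono) auto
  then show ?thesis
    using assms by (simp add: bellman_def)
qed

lemma bellman_sum:
  "(\<Sum>i\<in>A. bellman p (vol i) (J i) (P i) z)
    = bellman p (\<Sum>i\<in>A. vol i) (\<Sum>i\<in>A. J i) (\<Sum>i\<in>A. P i) z"
  unfolding bellman_def sum_subtractf sum_distrib_left[symmetric] sum.distrib by simp

section \<open>Dyadic subdivision of cubes\<close>

definition cube :: "'a::euclidean_space \<Rightarrow> real \<Rightarrow> 'a set" where
  "cube a l = cbox a (a + l *\<^sub>R One)"

lemma mem_cube: "x \<in> cube a l \<longleftrightarrow> (\<forall>b\<in>Basis. a \<bullet> b \<le> x \<bullet> b \<and> x \<bullet> b \<le> a \<bullet> b + l)"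
  by (simp add: cube_def mem_box inner_add_left)

definition vertices :: "'a::euclidean_space set" where
  "vertices = {v. \<forall>b\<in>Basis. v \<bullet> b = 0 \<or> v \<bullet> b = 1}"

lemma finite_vertices: "finite (vertices :: 'a::euclidean_space set)"
proof (rule finite_subset)
  show "vertices \<subseteq> (\<lambda>S. \<Sum>b\<in>S. b) ` Pow (Basis :: 'a set)"
  proof
    fix v :: 'a assume v: "v \<in> vertices"
    have "v = (\<Sum>b\<in>Basis. (v \<bullet> b) *\<^sub>R b)"
      by (simp add: euclidean_representation)
    also have "\<dots> = (\<Sum>b\<in>Basis. if v \<bullet> b = 1 then b else 0)"
      using v by (intro sum.cong) (auto simp: vertices_def)
    also have "\<dots> = (\<Sum>b\<in>{b\<in>Basis. v \<bullet> b = 1}. b)"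
      by (simp add: sum.inter_filter)
    finally show "v \<in> (\<lambda>S. \<Sum>b\<in>S. b) ` Pow (Basis :: 'a set)" by auto
  qed
qed auto

lemma zero_in_vertices: "0 \<in> vertices"
  by (simp add: vertices_def)

lemma One_in_vertices: "One \<in> vertices"
  by (simp add: vertices_def)

lemma measure_cube:
  fixes a :: "'a::euclidean_space"
  assumes "0 \<le> l"
  shows "measure lborel (cube a l) = l ^ DIM('a)"
  using assms by (simp add: cube_def content_cbox_if box_eq_empty inner_add_left)

lemma compact_cube: "compact (cube a l)"
  by (simp add: cube_def)

lemma child_subset:
  assumes "v \<in> vertices" "0 \<le> l"
  shows "cube (a + (l / 2) *\<^sub>R v) (l / 2) \<subseteq> cube a l"
proof
  fix x assume x: "x \<in> cube (a + (l / 2) *\<^sub>R v) (l / 2)"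
  show "x \<in> cube a l"
    unfolding mem_cube
  proof
    fix b :: 'a assume b: "b \<in> Basis"
    from assms(1) b have "v \<bullet> b = 0 \<or> v \<bullet> b = 1" by (simp add: vertices_def)
    with x b assms(2) show "a \<bullet> b \<le> x \<bullet> b \<and> x \<bullet> b \<le> a \<bullet> b + l"
      by (auto simp: mem_cube inner_add_left)
  qed
qed

lemma cube_children:
  assumes "x \<in> cube a l"
  shows "\<exists>v\<in>vertices. x \<in> cube (a + (l / 2) *\<^sub>R v) (l / 2)"
proof -
  define v where "v = (\<Sum>b\<in>Basis. (if x \<bullet> b \<ge> a \<bullet> b + l / 2 then 1 else 0) *\<^sub>R b)"
  have vb: "v \<bullet> b = (if x \<bullet> b \<ge> a \<bullet> b + l / 2 then 1 else 0)" if "b \<in> Basis" for b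
    using that unfolding v_def by (subst inner_sum_left_Basis) auto
  show ?thesis
  proof (intro bexI)
    show "v \<in> vertices" using vb by (auto simp: vertices_def)
    show "x \<in> cube (a + (l / 2) *\<^sub>R v) (l / 2)"
      using assms vb by (auto simp: mem_cube inner_add_left)
  qed
qed

text \<open>
  Two closed children of a cube differ in some coordinate direction, in which one lies in the
  lower and the other in the upper half, so they overlap in a null set at most.
\<close>

lemma cube_division:
  fixes a :: "'a::euclidean_space"
  assumes "0 < l"
  shows "(\<lambda>v. cube (a + (l / 2) *\<^sub>R v) (l / 2)) ` vertices division_of cube a l"
    and "inj_on (\<lambda>v. cube (a + (l / 2) *\<^sub>R v) (l / 2)) vertices"
proof -
  let ?C = "\<lambda>v. cube (a + (l / 2) *\<^sub>R v) (l / 2)"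
  have ne: "?C v \<noteq> {}" for v
    using assms mem_cube[of "a + (l / 2) *\<^sub>R v" "a + (l / 2) *\<^sub>R v" "l / 2"] by auto
  have disj: "interior (?C v) \<inter> interior (?C w) = {}"
    if vw: "v \<in> vertices" "w \<in> vertices" "v \<noteq> w" for v w
  proof -
    from vw(3) obtain b where b: "b \<in> Basis" "v \<bullet> b \<noteq> w \<bullet> b"
      by (meson euclidean_eqI)
    show ?thesis
    proof (rule ccontr)
      assume "\<not> ?thesis"
      then obtain x where "x \<in> interior (?C v)" "x \<in> interior (?C w)" by auto
      then have "(a + (l / 2) *\<^sub>R v) \<bullet> b < x \<bullet> b" "x \<bullet> b < (a + (l / 2) *\<^sub>R v + (l / 2) *\<^sub>R One) \<bullet> b"
        "(a + (l / 2) *\<^sub>R w) \<bullet> b < x \<bullet> b" "x \<bullet> b < (a + (l / 2) *\<^sub>R w + (l / 2) *\<^sub>R One) \<bullet> b"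
        using b(1) unfolding cube_def interior_cbox mem_box by auto
      moreover have "v \<bullet> b = 0 \<or> v \<bullet> b = 1" "w \<bullet> b = 0 \<or> w \<bullet> b = 1"
        using vw b(1) by (auto simp: vertices_def)
      ultimately show False
        using b by (auto simp: inner_add_left)
    qed
  qed
  show "inj_on ?C vertices"
  proof (rule inj_onI, rule ccontr)
    fix v w :: 'a
    assume "v \<in> vertices" "w \<in> vertices" "?C v = ?C w" "v \<noteq> w"
    with disj[of v w] have "interior (?C v) = {}" by simp
    moreover have "box (a + (l / 2) *\<^sub>R v) (a + (l / 2) *\<^sub>R v + (l / 2) *\<^sub>R One) \<noteq> {}"
      using assms by (simp add: box_ne_empty inner_add_left)
    ultimately show False by (simp add: cube_def)
  qed
  show "?C ` vertices division_of cube a l"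
  proof (rule division_ofI)
    show "finite (?C ` vertices)" by (intro finite_imageI finite_vertices)
    show "\<Union> (?C ` vertices) = cube a l"
      using child_subset[of _ l a] cube_children[of _ a l] assms by fastforce
    show "interior K \<inter> interior K' = {}"
      if "K \<in> ?C ` vertices" "K' \<in> ?C ` vertices" "K \<noteq> K'" for K K'
      using that disj by auto
  qed (use child_subset[of _ l a] assms ne in \<open>auto simp: cube_def\<close>)
qed

lemma integral_children:
  fixes a :: "'a::euclidean_space" and f :: "'a \<Rightarrow> real"
  assumes "0 < l" "f integrable_on cube a l"
  shows "integral (cube a l) f = (\<Sum>v\<in>vertices. integral (cube (a + (l / 2) *\<^sub>R v) (l / 2)) f)"
proof -
  have "integral (cube a l) f
      = (\<Sum>K\<in>(\<lambda>v. cube (a + (l / 2) *\<^sub>R v) (l / 2)) ` vertices. integral K f)"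
    by (rule integral_combine_division_topdown[OF assms(2) cube_division(1)[OF assms(1)]])
  also have "\<dots> = (\<Sum>v\<in>vertices. integral (cube (a + (l / 2) *\<^sub>R v) (l / 2)) f)"
    using sum.reindex[OF cube_division(2)[OF assms(1), of a]] by (simp add: o_def)
  finally show ?thesis .
qed

section \<open>Averages over a cube and over its dyadic children\<close>

lemma integral_affine_cube:
  fixes a c :: "'a::euclidean_space" and f :: "'a \<Rightarrow> real"
  assumes "0 < m" "continuous_on UNIV f" "0 \<le> l"
  shows "((\<lambda>x. f (m *\<^sub>R x + c)) has_integral
      integral (cube (m *\<^sub>R a + c) (m * l)) f / m ^ DIM('a)) (cube a l)"
proof -
  let ?Q = "cube (m *\<^sub>R a + c) (m * l)"
  have "f integrable_on ?Q"
    unfolding cube_def by (intro integrable_continuous continuous_on_subset[OF assms(2)]) auto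
  then have "(f has_integral integral ?Q f) (cbox (m *\<^sub>R a + c) (m *\<^sub>R a + c + (m * l) *\<^sub>R One))"
    unfolding cube_def by (rule integrable_integral)
  from has_integral_affinity[OF this, of m c] assms
  have "((\<lambda>x. f (m *\<^sub>R x + c)) has_integral integral ?Q f / m ^ DIM('a))
     ((\<lambda>x. (1 / m) *\<^sub>R x + - ((1 / m) *\<^sub>R c)) ` cbox (m *\<^sub>R a + c) (m *\<^sub>R a + c + (m * l) *\<^sub>R One))"
    by simp
  also have "(\<lambda>x. (1 / m) *\<^sub>R x + - ((1 / m) *\<^sub>R c)) ` cbox (m *\<^sub>R a + c) (m *\<^sub>R a + c + (m * l) *\<^sub>R One)
      = cube a l"
  proof -
    have "cbox (m *\<^sub>R a + c) (m *\<^sub>R a + c + (m * l) *\<^sub>R One) \<noteq> {}"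
      using assms by (simp add: box_ne_empty inner_add_left)
    then show ?thesis
      using assms(1) by (subst image_affinity_cbox) (simp add: cube_def algebra_simps)
  qed
  finally show ?thesis .
qed

text \<open>
  The affine contraction of the cube onto the child moves points along segments inside the cube,
  of length at most a multiple of \<open>l\<close>. The mean of \<open>u\<close> after contracting by a part \<open>s\<close> of the way
  is differentiable in \<open>s\<close>, and its derivative is an integral of the gradient over a cube of
  comparable size inside the original one.
\<close>

lemma average_child_diff:
  fixes u :: "'a::euclidean_space \<Rightarrow> real" and g :: "'a \<Rightarrow> 'a"
  assumes der: "\<And>x. (u has_derivative (\<lambda>h. g x \<bullet> h)) (at x)"
    and cont: "continuous_on UNIV g"
    and l: "0 < l" and v: "v \<in> vertices"
  shows "\<bar>integral (cube (a + (l / 2) *\<^sub>R v) (l / 2)) u / (l / 2) ^ DIM('a)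
            - integral (cube a l) u / l ^ DIM('a)\<bar>
          \<le> real DIM('a) * 2 ^ DIM('a) * l * (integral (cube a l) (\<lambda>x. norm (g x)) / l ^ DIM('a))"
proof -
  let ?n = "DIM('a)"
  let ?Q = "cube a l"
  define c where "c = (1 / 2) *\<^sub>R a + (l / 2) *\<^sub>R v"
  \<comment> \<open>The segment from \<open>x\<close> (at \<open>s = 0\<close>) to its image in the child (at \<open>s = 1\<close>).\<close>
  define T where "T s x = (1 - s / 2) *\<^sub>R x + s *\<^sub>R c" for s :: real and x
  have contu: "continuous_on UNIV u"
    using der has_derivative_continuous continuous_at_imp_continuous_on by blast
  have d: "norm (c - (1 / 2) *\<^sub>R x) \<le> ?n * l" if "x \<in> ?Q" for x
  proof -
    have "norm (c - (1 / 2) *\<^sub>R x) \<le> (\<Sum>b\<in>Basis. \<bar>(c - (1 / 2) *\<^sub>R x) \<bullet> b\<bar>)"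
      by (rule norm_le_l1)
    also have "\<dots> \<le> (\<Sum>b\<in>(Basis::'a set). l)"
    proof (rule sum_mono)
      fix b :: 'a assume b: "b \<in> Basis"
      have "v \<bullet> b = 0 \<or> v \<bullet> b = 1" using v b by (simp add: vertices_def)
      moreover have "a \<bullet> b \<le> x \<bullet> b" "x \<bullet> b \<le> a \<bullet> b + l" using that b by (auto simp: mem_cube)
      ultimately show "\<bar>(c - (1 / 2) *\<^sub>R x) \<bullet> b\<bar> \<le> l"
        using l by (auto simp: c_def inner_add_left inner_diff_left)
    qed
    finally show ?thesis by simp
  qed
  define F where "F s x = g (T s x) \<bullet> (c - (1 / 2) *\<^sub>R x)" for s x
  have contT: "continuous_on A (\<lambda>(s, x). T s x)" for A
    unfolding T_def case_prod_unfold by (intro continuous_intros) auto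
  have Tder: "((\<lambda>s. T s x) has_derivative (\<lambda>h. h *\<^sub>R (c - (1 / 2) *\<^sub>R x))) (at s)" for s x
    unfolding T_def by (auto intro!: derivative_eq_intros simp: algebra_simps)
  have fx: "((\<lambda>s. u (T s x)) has_field_derivative F s x) (at s within {0..1})" for s x
  proof -
    have "((\<lambda>s. u (T s x)) has_derivative (\<lambda>h. g (T s x) \<bullet> (h *\<^sub>R (c - (1 / 2) *\<^sub>R x)))) (at s within {0..1})"
      by (rule has_derivative_compose[OF has_derivative_at_withinI[OF Tder] der])
    then show ?thesis
      unfolding has_field_derivative_def F_def
      by (rule has_derivative_eq_rhs) (simp add: fun_eq_iff mult.commute)
  qed
  have contF: "continuous_on ({0..1} \<times> cbox a (a + l *\<^sub>R One)) (\<lambda>(s, x). F s x)"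
  proof -
    have "continuous_on ({0..1} \<times> cbox a (a + l *\<^sub>R One)) (\<lambda>z. g (T (fst z) (snd z)))"
      using continuous_on_compose2[OF cont contT[unfolded case_prod_unfold]] by simp
    then show ?thesis
      unfolding F_def case_prod_unfold by (intro continuous_intros)
  qed
  have intu: "(\<lambda>x. u (T s x)) integrable_on cbox a (a + l *\<^sub>R One)" for s
    unfolding T_def
    by (intro integrable_continuous continuous_on_compose2[OF contu] continuous_intros) auto
  define \<phi> where "\<phi> s = integral ?Q (\<lambda>x. u (T s x))" for s
  have phi: "(\<phi> has_field_derivative integral ?Q (F s)) (at s within {0..1})" if "s \<in> {0..1}" for s
    unfolding \<phi>_def cube_def
    by (rule leibniz_rule_field_derivative[OF fx intu contF that]) auto
  have bound: "norm (integral ?Q (F s)) \<le> ?n * l * 2 ^ ?n * integral ?Q (\<lambda>x. norm (g x))"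
    if s: "s \<in> {0..1}" for s
  proof -
    define m where "m = 1 - s / 2"
    have m: "1 / 2 \<le> m" "m \<le> 1" "0 < m" using s by (auto simp: m_def)
    let ?Q' = "cube (m *\<^sub>R a + s *\<^sub>R c) (m * l)"
    have contn: "continuous_on UNIV (\<lambda>x. norm (g x))"
      using cont by (intro continuous_intros)
    have sub: "?Q' \<subseteq> ?Q"
    proof
      fix x assume x: "x \<in> ?Q'"
      show "x \<in> ?Q" unfolding mem_cube
      proof
        fix b :: 'a assume b: "b \<in> Basis"
        have vb: "v \<bullet> b = 0 \<or> v \<bullet> b = 1" using v b by (simp add: vertices_def)
        have "(m *\<^sub>R a + s *\<^sub>R c) \<bullet> b = a \<bullet> b + s * (l / 2) * (v \<bullet> b)"
          by (simp add: m_def c_def inner_add_left algebra_simps)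
        moreover have "(m *\<^sub>R a + s *\<^sub>R c) \<bullet> b \<le> x \<bullet> b" "x \<bullet> b \<le> (m *\<^sub>R a + s *\<^sub>R c) \<bullet> b + m * l"
          using x b by (auto simp: mem_cube)
        moreover have "0 \<le> s * (l / 2) * (v \<bullet> b)" "s * (l / 2) * (v \<bullet> b) + m * l \<le> l"
          using vb s l by (auto simp: m_def algebra_simps)
        ultimately show "a \<bullet> b \<le> x \<bullet> b \<and> x \<bullet> b \<le> a \<bullet> b + l" by linarith
      qed
    qed
    have Tm: "T s x = m *\<^sub>R x + s *\<^sub>R c" for x by (simp add: T_def m_def)
    have hi: "((\<lambda>x. norm (g (T s x))) has_integral
        integral ?Q' (\<lambda>x. norm (g x)) / m ^ ?n) ?Q"
      unfolding Tm using integral_affine_cube[OF m(3) contn, of l "s *\<^sub>R c" a] l by simp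
    have intF: "F s integrable_on ?Q"
      unfolding F_def T_def cube_def
      by (intro integrable_continuous continuous_intros continuous_on_compose2[OF cont]) auto
    have intn: "(\<lambda>x. norm (g x)) integrable_on cube b k" for b k
      unfolding cube_def by (intro integrable_continuous continuous_on_subset[OF contn]) auto
    have hi2: "((\<lambda>x. (?n * l) * norm (g (T s x))) has_integral
        (?n * l) * (integral ?Q' (\<lambda>x. norm (g x)) / m ^ ?n)) ?Q"
      using has_integral_mult_right[OF hi, of "?n * l"] by simp
    have "norm (integral ?Q (F s)) \<le> integral ?Q (\<lambda>x. (?n * l) * norm (g (T s x)))"
    proof (rule integral_norm_bound_integral[OF intF has_integral_integrable[OF hi2]])
      fix x assume x: "x \<in> ?Q"
      have "norm (F s x) \<le> norm (g (T s x)) * norm (c - (1 / 2) *\<^sub>R x)"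
        unfolding F_def real_norm_def by (rule Cauchy_Schwarz_ineq2)
      also have "\<dots> \<le> norm (g (T s x)) * (?n * l)"
        using d[OF x] by (intro mult_left_mono) auto
      finally show "norm (F s x) \<le> (?n * l) * norm (g (T s x))" by (simp add: mult_ac)
    qed
    also have "\<dots> = (?n * l) * (integral ?Q' (\<lambda>x. norm (g x)) / m ^ ?n)"
      by (rule integral_unique[OF hi2])
    also have "\<dots> \<le> (?n * l) * (2 ^ ?n * integral ?Q (\<lambda>x. norm (g x)))"
    proof (rule mult_left_mono)
      have I': "integral ?Q' (\<lambda>x. norm (g x)) \<le> integral ?Q (\<lambda>x. norm (g x))"
        by (rule integral_subset_le[OF sub intn intn]) auto
      have "(1 / 2) ^ ?n \<le> m ^ ?n"
        using m by (intro power_mono) auto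
      then have "1 / m ^ ?n \<le> 2 ^ ?n"
        using m by (simp add: field_simps power_divide)
      then have "integral ?Q' (\<lambda>x. norm (g x)) * (1 / m ^ ?n)
          \<le> integral ?Q (\<lambda>x. norm (g x)) * 2 ^ ?n"
        using I' m by (intro mult_mono integral_nonneg intn) auto
      then show "integral ?Q' (\<lambda>x. norm (g x)) / m ^ ?n \<le> 2 ^ ?n * integral ?Q (\<lambda>x. norm (g x))"
        by (simp add: mult_ac)
    qed (use l in auto)
    finally show ?thesis by (simp add: mult_ac)
  qed
  have "norm (\<phi> 1 - \<phi> 0) \<le> ?n * l * 2 ^ ?n * integral ?Q (\<lambda>x. norm (g x)) * norm (1 - 0 :: real)"
    by (rule field_differentiable_bound[where S = "{0..1}"]) (use phi bound in auto)
  moreover have "\<phi> 0 = integral ?Q u"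
    by (simp add: \<phi>_def T_def)
  moreover have "\<phi> 1 = integral (cube (a + (l / 2) *\<^sub>R v) (l / 2)) u * 2 ^ ?n"
  proof -
    have "((\<lambda>x. u ((1 / 2) *\<^sub>R x + c)) has_integral
      integral (cube ((1 / 2) *\<^sub>R a + c) (1 / 2 * l)) u / (1 / 2) ^ DIM('a)) (cube a l)"
      by (rule integral_affine_cube[OF _ contu]) (use l in auto)
    moreover have "(1 / 2) *\<^sub>R a + c = a + (l / 2) *\<^sub>R v"
      by (simp add: c_def scaleR_left_distrib[symmetric] add.assoc[symmetric])
    ultimately show ?thesis
      by (simp add: \<phi>_def T_def integral_unique power_divide)
  qed
  ultimately have *: "\<bar>integral (cube (a + (l / 2) *\<^sub>R v) (l / 2)) u * 2 ^ ?n - integral ?Q u\<bar>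
      \<le> ?n * l * 2 ^ ?n * integral ?Q (\<lambda>x. norm (g x))" by simp
  have "\<bar>integral (cube (a + (l / 2) *\<^sub>R v) (l / 2)) u / (l / 2) ^ ?n - integral ?Q u / l ^ ?n\<bar>
      = \<bar>(integral (cube (a + (l / 2) *\<^sub>R v) (l / 2)) u * 2 ^ ?n - integral ?Q u) / l ^ ?n\<bar>"
    by (simp add: power_divide diff_divide_distrib)
  also have "\<dots> \<le> ?n * l * 2 ^ ?n * integral ?Q (\<lambda>x. norm (g x)) / l ^ ?n"
    using * l by (simp add: abs_divide divide_right_mono)
  finally show ?thesis by (simp add: mult_ac)
qed

text \<open>
  Integrate Young's inequality at the mean value.
\<close>

lemma jensen_cube:
  fixes f :: "'a::euclidean_space \<Rightarrow> real"
  assumes "1 < p" "0 < l" "continuous_on UNIV f" "\<And>x. 0 \<le> f x"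
  shows "(integral (cube a l) f / l ^ DIM('a)) powr p * l ^ DIM('a)
    \<le> integral (cube a l) (\<lambda>x. f x powr p)"
proof -
  let ?V = "l ^ DIM('a)" and ?Q = "cube a l"
  define y where "y = integral ?Q f / ?V"
  have V: "0 < ?V" using assms by simp
  have intf: "f integrable_on ?Q"
    unfolding cube_def by (intro integrable_continuous continuous_on_subset[OF assms(3)]) auto
  have intp: "(\<lambda>x. f x powr p) integrable_on ?Q"
    unfolding cube_def using assms
    by (intro integrable_continuous continuous_on_powr' continuous_on_subset[OF assms(3)] continuous_intros) auto
  have y: "0 \<le> y" unfolding y_def using V assms intf by (intro divide_nonneg_pos integral_nonneg) auto
  have yy: "y powr p = y powr (p - 1) * y"
    using y powr_mult_base[of y "p - 1"] by (simp add: mult.commute)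
  have c: "((\<lambda>x. (p - 1) * y powr p) has_integral (?V * ((p - 1) * y powr p))) ?Q"
    using has_integral_const[of "(p - 1) * y powr p" a "a + l *\<^sub>R One"] measure_cube[of l a] assms
    by (simp add: cube_def)
  have "integral ?Q (\<lambda>x. p * y powr (p - 1) * f x)
      \<le> integral ?Q (\<lambda>x. (p - 1) * y powr p + f x powr p)"
    using assms y intf intp c
    by (intro integral_le young_powr integrable_add integrable_on_mult_right) auto
  also have "\<dots> = ?V * ((p - 1) * y powr p) + integral ?Q (\<lambda>x. f x powr p)"
    using integral_unique[OF c] by (subst integral_add) (use c intp in auto)
  also have "integral ?Q (\<lambda>x. p * y powr (p - 1) * f x) = p * y powr (p - 1) * (y * ?V)"
    using V by (simp add: y_def)
  finally have "y powr p * ?V \<le> integral ?Q (\<lambda>x. f x powr p)"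
    by (simp add: yy algebra_simps)
  then show ?thesis by (simp add: y_def)
qed

section \<open>The dyadic tree of a cube\<close>

text \<open>
  The vertices of the tree are the finite words in the numbers that enumerate the children of a
  cube. The most recent choice stands first, so that the tails of a word are its ancestors.
\<close>

locale dyadic_tree =
  fixes p :: real and a0 :: "'a::euclidean_space" and l0 :: real and G :: "'a set"
  assumes p_gt_1: "1 < p" and l0_pos: "0 < l0"
begin

definition offset :: "nat \<Rightarrow> 'a" where
  "offset = from_nat_into vertices"

definition side :: "nat list \<Rightarrow> real" where
  "side v = l0 / 2 ^ length v"

primrec corner :: "nat list \<Rightarrow> 'a" where
  "corner [] = a0"
| "corner (i # v) = corner v + (side v / 2) *\<^sub>R offset i"

definition Q :: "nat list \<Rightarrow> 'a set" where
  "Q v = cube (corner v) (side v)"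

definition digits :: "nat set" where
  "digits = {..<card (vertices :: 'a set)}"

definition weight :: "nat list \<Rightarrow> real" where
  "weight v = side v powr (real DIM('a) - p)"

text \<open>
  The conductance from the top of a cube to the leaves that are at most \<open>N\<close> generations below it.
  Only finitely many cubes are involved, so the leaves that count form a compact subset of \<open>G\<close>.
\<close>

primrec cond_upto :: "nat \<Rightarrow> nat list \<Rightarrow> real" where
  "cond_upto 0 v = (if Q v \<subseteq> G then weight v else 0)"
| "cond_upto (Suc N) v = (if Q v \<subseteq> G then weight v
     else series_cond p (weight v) (\<Sum>i\<in>digits. cond_upto N (i # v)))"

lemma side_pos: "0 < side v"
  using l0_pos by (simp add: side_def)

lemma side_nz [simp]: "side v \<noteq> 0"
  using side_pos[of v] by simp

lemma side_Cons: "side (i # v) = side v / 2"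
  by (simp add: side_def)

lemma weight_pos: "0 < weight v"
  using side_pos by (simp add: weight_def)

lemma finite_digits: "finite digits"
  by (simp add: digits_def)

lemma offset_in_vertices: "offset i \<in> vertices"
  unfolding offset_def using zero_in_vertices by (intro from_nat_into) auto

lemma offset_bij: "bij_betw offset digits vertices"
  unfolding offset_def digits_def by (rule bij_betw_from_nat_into_finite[OF finite_vertices])

lemma Q_Cons_subset: "Q (i # v) \<subseteq> Q v"
  using child_subset[OF offset_in_vertices, of "side v" "corner v" i] side_pos[of v]
  by (simp add: Q_def side_Cons)

lemma Q_children:
  assumes "x \<in> Q v"
  shows "\<exists>i\<in>digits. x \<in> Q (i # v)"
proof -
  obtain y where y: "y \<in> vertices" "x \<in> cube (corner v + (side v / 2) *\<^sub>R y) (side v / 2)"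
    using cube_children[of x "corner v" "side v"] assms by (auto simp: Q_def)
  then obtain i where "i \<in> digits" "y = offset i"
    using offset_bij by (auto simp: bij_betw_def)
  with y show ?thesis by (auto simp: Q_def side_Cons)
qed

lemma integral_Q_children:
  assumes "f integrable_on Q v"
  shows "integral (Q v) f = (\<Sum>i\<in>digits. integral (Q (i # v)) (f :: 'a \<Rightarrow> real))"
proof -
  have "integral (Q v) f
      = (\<Sum>x\<in>vertices. integral (cube (corner v + (side v / 2) *\<^sub>R x) (side v / 2)) f)"
    unfolding Q_def using assms by (intro integral_children side_pos) (simp add: Q_def)
  also have "\<dots> = (\<Sum>i\<in>digits. integral (Q (i # v)) f)"
    unfolding Q_def by (subst sum.reindex_bij_betw[OF offset_bij, symmetric]) (simp add: side_Cons)
  finally show ?thesis .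
qed

lemma cond_upto_bounds: "0 \<le> cond_upto N v \<and> cond_upto N v \<le> weight v"
proof (cases N)
  case 0
  then show ?thesis using weight_pos[of v] by simp
next
  case (Suc N)
  then show ?thesis
    using weight_pos[of v] series_cond_nonneg series_cond_le[OF p_gt_1 weight_pos] by simp
qed

lemma cond_upto_mono: "cond_upto N v \<le> cond_upto (Suc N) v"
proof (induction N arbitrary: v)
  case 0
  then show ?case using series_cond_nonneg by simp
next
  case (Suc N)
  have "series_cond p (weight v) (\<Sum>i\<in>digits. cond_upto N (i # v))
      \<le> series_cond p (weight v) (\<Sum>i\<in>digits. cond_upto (Suc N) (i # v))"
    using Suc by (intro series_cond_mono p_gt_1 weight_pos sum_mono)
  then show ?case
    by (simp only: cond_upto.simps(2) split: if_split) simp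
qed

lemma incseq_cond_upto: "incseq (\<lambda>N. cond_upto N v)"
  using cond_upto_mono by (intro incseq_SucI)

subsection \<open>Truncated conductances are dominated by the energy\<close>

text \<open>
  The constant in \<open>average_child_diff\<close>.
\<close>

definition jump_const :: real where
  "jump_const = real DIM('a) * 2 ^ DIM('a)"

lemma jump_const_pos: "0 < jump_const"
  by (simp add: jump_const_def)

text \<open>
  The quantity \<open>av u + 2 B l z\<close>, with \<open>av u\<close> the mean of \<open>u\<close> over the cube, \<open>B\<close> the constant
  \<open>jump_const\<close> and \<open>z\<close> the running maximum of the means of the gradient above the cube, is an upper
  bound for the part of the value of \<open>u\<close> reached so far. It is built so that it increases by
  at most \<open>2 B l (z' - z)\<close> from a cube to a child, where \<open>z'\<close> is the new maximum: the term \<open>2 B l z'\<close>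
  loses half of its size when the side is halved, which covers the change \<open>B l z'\<close> of the mean of
  \<open>u\<close>. This is the summation by parts along a branch. On a leaf \<open>u \<ge> 1\<close>, so nothing is left to be
  reached. The increments are the voltages of an admissible potential of the network, and their
  energies are paid by the Bellman function.
\<close>

lemma cond_upto_bellman:
  fixes u :: "'a \<Rightarrow> real" and g :: "'a \<Rightarrow> 'a"
  assumes der: "\<And>x. (u has_derivative (\<lambda>h. g x \<bullet> h)) (at x)"
    and cont: "continuous_on UNIV g"
    and leaf: "\<And>v x. set v \<subseteq> digits \<Longrightarrow> length v \<le> L \<Longrightarrow> Q v \<subseteq> G \<Longrightarrow> x \<in> Q v \<Longrightarrow> 1 \<le> u x"
    and "N + length v \<le> L" "set v \<subseteq> digits" "0 \<le> z"
  shows "cond_upto N v *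
      max 0 (1 - (integral (Q v) u / side v ^ DIM('a) + 2 * jump_const * side v * z)) powr p
    \<le> (2 * jump_const) powr p *
      bellman p (side v ^ DIM('a)) (integral (Q v) (\<lambda>x. norm (g x)))
        (integral (Q v) (\<lambda>x. norm (g x) powr p)) z"
proof -
  define av where "av v = integral (Q v) u / side v ^ DIM('a)" for v
  define J where "J v = integral (Q v) (\<lambda>x. norm (g x))" for v
  define P where "P v = integral (Q v) (\<lambda>x. norm (g x) powr p)" for v
  let ?B = "\<lambda>v z. bellman p (side v ^ DIM('a)) (J v) (P v) z"
  have contn: "continuous_on UNIV (\<lambda>x. norm (g x))"
    using cont by (intro continuous_intros)
  have contp: "continuous_on UNIV (\<lambda>x. norm (g x) powr p)"
    using cont p_gt_1 by (intro continuous_on_powr' continuous_intros) auto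
  have contu: "continuous_on UNIV u"
    using der has_derivative_continuous continuous_at_imp_continuous_on by blast
  have int: "h integrable_on Q v" if "continuous_on UNIV h" for h :: "'a \<Rightarrow> real" and v
    unfolding Q_def cube_def using continuous_on_subset[OF that] by (intro integrable_continuous) auto
  have vol: "integral (Q v) (\<lambda>x. 1) = side v ^ DIM('a)" for v
    using measure_cube[of "side v" "corner v"] side_pos[of v] by (simp add: Q_def cube_def)
  have vol_children: "(\<Sum>i\<in>digits. side (i # v) ^ DIM('a)) = side v ^ DIM('a)" for v
    using integral_Q_children[OF int, of "\<lambda>x. 1" v] by (simp add: vol)
  have J_children: "(\<Sum>i\<in>digits. J (i # v)) = J v" for v
    unfolding J_def by (rule integral_Q_children[OF int[OF contn], symmetric])
  have P_children: "(\<Sum>i\<in>digits. P (i # v)) = P v" for v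
    unfolding P_def by (rule integral_Q_children[OF int[OF contp], symmetric])
  have J_nonneg: "0 \<le> J v" for v
    unfolding J_def by (intro integral_nonneg int contn) auto
  have bell_nonneg: "0 \<le> (2 * jump_const) powr p * ?B v z" if "0 \<le> z" for z v
  proof -
    have "0 \<le> bellman p (side v ^ DIM('a)) (J v / side v ^ DIM('a) * side v ^ DIM('a)) (P v) z"
      using jensen_cube[OF p_gt_1 side_pos[of v] contn, of "corner v"] J_nonneg[of v] side_pos[of v] that p_gt_1
      by (intro bellman_nonneg) (auto simp: J_def P_def Q_def)
    then show ?thesis by simp
  qed
  have leaf0: "max 0 (1 - (av v + 2 * jump_const * side v * z)) = 0"
    if "set v \<subseteq> digits" "length v \<le> L" "Q v \<subseteq> G" "0 \<le> z" for v z
  proof -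
    have "integral (Q v) (\<lambda>x. 1) \<le> integral (Q v) u"
      using leaf that by (intro integral_le int contu) auto
    then have "1 \<le> av v"
      using side_pos[of v] by (simp add: av_def vol)
    moreover have "0 \<le> 2 * jump_const * side v * z"
      using that jump_const_pos side_pos[of v] by simp
    ultimately show ?thesis by (intro max_absorb1) linarith
  qed
  show ?thesis
    unfolding av_def[symmetric] J_def[symmetric] P_def[symmetric]
    using assms(4-6)
  proof (induction N arbitrary: v z)
    case (0 v z)
    have "0 \<le> (2 * jump_const) powr p * ?B v z" by (rule bell_nonneg[OF 0(3)])
    then show ?case using leaf0[of v z] 0 by (cases "Q v \<subseteq> G") simp_all
  next
    case (Suc N v z)
    show ?case
    proof (cases "Q v \<subseteq> G")
      case True
      then show ?thesis using leaf0[of v z] bell_nonneg[of z v] Suc.prems by simp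
    next
      case False
      define y where "y = J v / side v ^ DIM('a)"
      have y: "0 \<le> y" "J v = y * side v ^ DIM('a)"
        using J_nonneg[of v] side_pos[of v] by (auto simp: y_def)
      define z' where "z' = max z y"
      have z': "z \<le> z'" "y \<le> z'" "0 \<le> z'" using Suc.prems by (auto simp: z'_def)
      \<comment> \<open>The voltage across the cube itself.\<close>
    define s where "s = 2 * jump_const * side v * (z' - z)"
      have s: "0 \<le> s" using z' jump_const_pos side_pos[of v] by (simp add: s_def)
      define t where "t = max 0 (1 - (av v + 2 * jump_const * side v * z) - s)"
      let ?C = "\<Sum>i\<in>digits. cond_upto N (i # v)"
      have C: "0 \<le> ?C" using cond_upto_bounds by (intro sum_nonneg) auto
      have child: "cond_upto N (i # v) * t powr p \<le> (2 * jump_const) powr p * ?B (i # v) z'"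
        if i: "i \<in> digits" for i
      proof -
        have "\<bar>av (i # v) - av v\<bar> \<le> jump_const * side v * y"
          using average_child_diff[OF der cont side_pos[of v] offset_in_vertices[of i], of "corner v"]
          by (simp add: av_def y_def J_def Q_def side_Cons jump_const_def)
        moreover have "jump_const * side v * y \<le> jump_const * side v * z'"
          using z' jump_const_pos side_pos[of v] by (intro mult_left_mono) auto
        ultimately have "t \<le> max 0 (1 - (av (i # v) + 2 * jump_const * side (i # v) * z'))"
          by (auto simp: t_def s_def side_Cons algebra_simps)
        then have "cond_upto N (i # v) * t powr p \<le> cond_upto N (i # v) *
            max 0 (1 - (av (i # v) + 2 * jump_const * side (i # v) * z')) powr p"
          using cond_upto_bounds p_gt_1 by (intro mult_left_mono powr_mono2) (auto simp: t_def)
        also have "\<dots> \<le> (2 * jump_const) powr p * ?B (i # v) z'"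
          using Suc.IH[of "i # v" z'] Suc.prems i z' by simp
        finally show ?thesis .
      qed
      have "cond_upto (Suc N) v * max 0 (1 - (av v + 2 * jump_const * side v * z)) powr p
          \<le> series_cond p (weight v) ?C * (s + t) powr p"
        using False p_gt_1 s
        by (auto simp: t_def intro!: mult_left_mono powr_mono2 series_cond_nonneg)
      also have "\<dots> \<le> weight v * s powr p + ?C * t powr p"
        by (rule series_cond_energy) (use p_gt_1 weight_pos C s in \<open>auto simp: t_def\<close>)
      also have "?C * t powr p \<le> (\<Sum>i\<in>digits. (2 * jump_const) powr p * ?B (i # v) z')"
        unfolding sum_distrib_right by (intro sum_mono child)
      also have "\<dots> = (2 * jump_const) powr p * ?B v z'"
        unfolding sum_distrib_left[symmetric] bellman_sum vol_children J_children P_children ..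
      also have "weight v * s powr p
          = (2 * jump_const) powr p * (side v ^ DIM('a) * (z' - z) powr p)"
      proof -
        have "weight v * side v powr p = side v ^ DIM('a)"
          using side_pos[of v] by (simp add: weight_def powr_add[symmetric] powr_realpow)
        moreover have "weight v * s powr p
            = (2 * jump_const) powr p * ((weight v * side v powr p) * (z' - z) powr p)"
          by (simp only: s_def powr_mult mult_ac)
        ultimately show ?thesis by simp
      qed
      also have "\<dots> \<le> (2 * jump_const) powr p * (side v ^ DIM('a) * (z' powr p - z powr p))"
        using z' Suc.prems p_gt_1 side_pos[of v]
        by (intro mult_left_mono powr_diff_le) (auto intro: less_imp_le)
      finally have "cond_upto (Suc N) v * max 0 (1 - (av v + 2 * jump_const * side v * z)) powr p
          \<le> (2 * jump_const) powr p * (side v ^ DIM('a) * (z' powr p - z powr p) + ?B v z')"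
        by (simp add: distrib_left)
      also have "\<dots> \<le> (2 * jump_const) powr p * ?B v z"
        unfolding z'_def y(2)
        by (intro mult_left_mono bellman_step) (use p_gt_1 side_pos[of v] y Suc.prems in auto)
      finally show ?thesis .
    qed
  qed
qed

text \<open>
  Since \<open>u\<close> vanishes on one child, its mean over the root is at most \<open>B l\<close> times the mean of the
  gradient. If that mean is at most \<open>1/2\<close>, the leaves must be reached from there; otherwise the
  energy in the root alone is large compared with the conductance of the root.
\<close>

lemma cond_upto_root_le:
  fixes u :: "'a \<Rightarrow> real" and g :: "'a \<Rightarrow> 'a"
  assumes der: "\<And>x. (u has_derivative (\<lambda>h. g x \<bullet> h)) (at x)"
    and cont: "continuous_on UNIV g"
    and leaf: "\<And>v x. set v \<subseteq> digits \<Longrightarrow> length v \<le> N \<Longrightarrow> Q v \<subseteq> G \<Longrightarrow> x \<in> Q v \<Longrightarrow> 1 \<le> u x"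
    and zero: "\<And>x. x \<in> cube (a0 + (l0 / 2) *\<^sub>R e) (l0 / 2) \<Longrightarrow> u x = 0" "e \<in> vertices"
  shows "cond_upto N [] \<le> (2 * jump_const) powr p * (2 powr p * (2 / (p - 1) * young_const p) + 1)
    * integral (Q []) (\<lambda>x. norm (g x) powr p)"
proof -
  let ?V = "l0 ^ DIM('a)"
  define J where "J = integral (Q []) (\<lambda>x. norm (g x))"
  define P where "P = integral (Q []) (\<lambda>x. norm (g x) powr p)"
  define K where "K = (2 * jump_const) powr p"
  define D where "D = 2 / (p - 1) * young_const p"
  have D: "0 \<le> D" using p_gt_1 by (simp add: D_def young_const_def)
  have K: "0 \<le> K" by (simp add: K_def)
  have contn: "continuous_on UNIV (\<lambda>x. norm (g x))"
    using cont by (intro continuous_intros)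
  have "0 \<le> (J / ?V) powr p * ?V" using l0_pos by simp
  also have jen: "(J / ?V) powr p * ?V \<le> P"
    using jensen_cube[OF p_gt_1 l0_pos contn, of a0] by (simp add: J_def P_def Q_def side_def)
  finally have P: "0 \<le> P" .
  define A where "A = integral (Q []) u / ?V"
  have "integral (cube (a0 + (l0 / 2) *\<^sub>R e) (l0 / 2)) u = 0"
    using zero(1) integral_cong[of "cube (a0 + (l0 / 2) *\<^sub>R e) (l0 / 2)" u "\<lambda>_. 0"] by simp
  then have "\<bar>A\<bar> \<le> jump_const * l0 * (J / ?V)"
    using average_child_diff[OF der cont l0_pos zero(2), of a0]
    by (simp add: A_def J_def Q_def side_def jump_const_def)
  then have A: "A \<le> jump_const * l0 * (J / ?V)" by simp
  show ?thesis
  proof (cases "A \<le> 1 / 2")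
    case True
    have "cond_upto N [] * (1 / 2) powr p \<le> cond_upto N [] *
        max 0 (1 - (A + 2 * jump_const * l0 * 0)) powr p"
      using True p_gt_1 cond_upto_bounds by (intro mult_left_mono powr_mono2) auto
    also have "\<dots> \<le> K * bellman p ?V J P 0"
      using cond_upto_bellman[where N = N and L = N and v = "[]" and z = 0 and u = u and g = g, OF der cont leaf]
      by (simp add: A_def J_def P_def K_def side_def)
    also have "bellman p ?V J P 0 = D * P"
      using p_gt_1 by (simp add: bellman_def D_def)
    finally have "2 powr p * (cond_upto N [] * (1 / 2) powr p) \<le> 2 powr p * (K * (D * P))"
      by (rule mult_left_mono) simp
    moreover have "2 powr p * (1 / 2) powr p = (1 :: real)"
      by (simp add: powr_mult[symmetric])
    then have "2 powr p * (cond_upto N [] * (1 / 2) powr p) = cond_upto N []"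
      by (simp only: mult.left_commute[of _ "cond_upto N []"] mult_1_right)
    ultimately have "cond_upto N [] \<le> K * (2 powr p * D) * P"
      by (simp add: mult_ac)
    also have "\<dots> \<le> K * (2 powr p * D + 1) * P"
      using K P by (intro mult_right_mono mult_left_mono) auto
    finally show ?thesis by (simp add: K_def D_def P_def)
  next
    case False
    with A have "1 \<le> 2 * (jump_const * l0 * (J / ?V))" by linarith
    then have "1 \<le> 2 * jump_const * (l0 * (J / ?V))" by (simp only: mult.assoc)
    then have "1 powr p \<le> (2 * jump_const * (l0 * (J / ?V))) powr p"
      using p_gt_1 by (intro powr_mono2) auto
    also have "\<dots> = K * (l0 powr p * (J / ?V) powr p)"
      by (simp only: K_def powr_mult mult.assoc)
    finally have one: "1 \<le> K * (l0 powr p * (J / ?V) powr p)" by simp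
    have w: "weight [] * l0 powr p = ?V"
      using l0_pos by (simp add: weight_def side_def powr_add[symmetric] powr_realpow)
    have "cond_upto N [] \<le> weight [] * 1" using cond_upto_bounds by simp
    also have "\<dots> \<le> weight [] * (K * (l0 powr p * (J / ?V) powr p))"
      using one weight_pos[of "[]"] by (intro mult_left_mono) auto
    also have "\<dots> = K * ((J / ?V) powr p * ?V)"
      by (simp add: w[symmetric] mult_ac)
    also have "\<dots> \<le> K * P" using K jen by (intro mult_left_mono)
    also have "\<dots> = K * 1 * P" by simp
    also have "\<dots> \<le> K * (2 powr p * D + 1) * P"
      using K P D by (intro mult_right_mono mult_left_mono) auto
    finally show ?thesis by (simp add: K_def D_def P_def)
  qed
qed


section \<open>The equilibrium flow\<close>

definition cond :: "nat list \<Rightarrow> real" where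
  "cond v = (SUP N. cond_upto N v)"

lemma bdd_above_cond_upto: "bdd_above (range (\<lambda>N. cond_upto N v))"
  using cond_upto_bounds by (auto simp: bdd_above_def)

lemma cond_upto_tendsto: "(\<lambda>N. cond_upto N v) \<longlonglongrightarrow> cond v"
  unfolding cond_def by (rule LIMSEQ_incseq_SUP[OF bdd_above_cond_upto incseq_cond_upto])

lemma cond_nonneg: "0 \<le> cond v"
  by (rule LIMSEQ_le_const[OF cond_upto_tendsto]) (use cond_upto_bounds in auto)

lemma cond_le: "(\<And>N. cond_upto N v \<le> b) \<Longrightarrow> cond v \<le> b"
  by (rule LIMSEQ_le_const2[OF cond_upto_tendsto]) auto

lemma cond_leaf:
  assumes "Q v \<subseteq> G"
  shows "cond v = weight v"
proof -
  have "cond_upto N v = weight v" for N using assms by (cases N) auto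
  then show ?thesis by (simp add: cond_def)
qed

lemma cond_node:
  assumes "\<not> Q v \<subseteq> G"
  shows "cond v = series_cond p (weight v) (\<Sum>i\<in>digits. cond (i # v))"
proof (rule LIMSEQ_unique)
  show "(\<lambda>N. cond_upto (Suc N) v) \<longlonglongrightarrow> cond v"
    by (rule LIMSEQ_Suc[OF cond_upto_tendsto])
  have "(\<lambda>N. series_cond p (weight v) (\<Sum>i\<in>digits. cond_upto N (i # v)))
      \<longlonglongrightarrow> series_cond p (weight v) (\<Sum>i\<in>digits. cond (i # v))"
  proof (intro tendsto_series_cond p_gt_1 weight_pos tendsto_sum cond_upto_tendsto)
    show "incseq (\<lambda>N. \<Sum>i\<in>digits. cond_upto N (i # v))"
      using incseq_cond_upto by (auto simp: incseq_def intro!: sum_mono)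
  qed (use cond_upto_bounds in \<open>auto intro!: sum_nonneg\<close>)
  then show "(\<lambda>N. cond_upto (Suc N) v) \<longlonglongrightarrow> series_cond p (weight v) (\<Sum>i\<in>digits. cond (i # v))"
    using assms by simp
qed

primrec mass :: "nat list \<Rightarrow> real" where
  "mass [] = cond []"
| "mass (i # v) = mass v * (cond (i # v) / (\<Sum>j\<in>digits. cond (j # v)))"

definition drop_across :: "nat list \<Rightarrow> real" where
  "drop_across v = (mass v / weight v) powr (1 / (p - 1))"

text \<open>
  The voltage that remains at the top of a cube when the root is at voltage \<open>1\<close>.
\<close>

primrec level :: "nat list \<Rightarrow> real" where
  "level [] = 1"
| "level (i # v) = level v - drop_across v"

primrec potential :: "nat list \<Rightarrow> real" where
  "potential [] = drop_across []"
| "potential (i # v) = potential v + drop_across (i # v)"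

primrec above_leaves :: "nat list \<Rightarrow> bool" where
  "above_leaves [] = True"
| "above_leaves (i # v) = (\<not> Q v \<subseteq> G \<and> above_leaves v)"

lemma mass_nonneg: "0 \<le> mass v"
  by (induction v) (auto simp: cond_nonneg sum_nonneg)

text \<open>
  Ohm's law \<open>mass = cond * level\<^bsup>p-1\<^esup>\<close> is preserved from a cube to its children, because the flow is
  split in proportion to their conductances. Below a leaf it would make no sense, hence
  \<open>above_leaves\<close>.
\<close>

lemma mass_eq_cond_level:
  "above_leaves v \<Longrightarrow> set v \<subseteq> digits \<Longrightarrow> 0 < cond v \<Longrightarrow>
    0 \<le> level v \<and> mass v = cond v * level v powr (p - 1)"
proof (induction v)
  case (Cons i v)
  let ?e = "1 / (p - 1)"
  define C where "C = (\<Sum>j\<in>digits. cond (j # v))"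
  define c where "c = cond v"
  define w where "w = weight v"
  define r where "r = level v"
  have "cond (i # v) \<le> C"
    unfolding C_def using Cons.prems cond_nonneg by (intro member_le_sum) (auto simp: finite_digits)
  with Cons.prems have C: "0 < C" by simp
  have w: "0 < w" by (simp add: w_def weight_pos)
  have cser: "c = series_cond p w C"
    using cond_node[of v] Cons.prems by (simp add: c_def w_def C_def)
  then have c: "0 < c" using series_cond_pos[OF w C] by simp
  have IH: "0 \<le> r" "mass v = c * r powr (p - 1)"
    using Cons c by (auto simp: r_def c_def)
  have split: "(c / w) powr ?e + (c / C) powr ?e = 1"
  proof -
    have e: "- 1 / (p - 1) = - ?e" by simp
    have "c powr (- ?e) = w powr (- ?e) + C powr (- ?e)"
      using series_cond_resistance[OF p_gt_1 w C] unfolding cser e .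
    then have "c powr ?e * c powr (- ?e) = c powr ?e * (w powr (- ?e) + C powr (- ?e))"
      by simp
    moreover have "c powr ?e * c powr (- ?e) = 1"
      using c by (simp add: powr_add[symmetric])
    moreover have "(c / x) powr ?e = c powr ?e * x powr (- ?e)" for x
      unfolding powr_divide by (simp only: powr_minus divide_inverse)
    ultimately show ?thesis by (simp only: distrib_left)
  qed
  have pw: "(r powr (p - 1)) powr ?e = r"
    using IH p_gt_1 by (simp add: powr_powr)
  have "drop_across v = (c / w * r powr (p - 1)) powr ?e"
    by (simp add: drop_across_def IH w_def)
  also have "\<dots> = (c / w) powr ?e * r"
    by (simp only: powr_mult pw)
  finally have lev: "level (i # v) = r * (c / C) powr ?e"
    using split by (simp add: r_def algebra_simps) (metis distrib_left mult.right_neutral)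
  have "level (i # v) powr (p - 1) = r powr (p - 1) * (c / C)"
    unfolding lev using p_gt_1 c C by (simp add: powr_mult powr_powr)
  then have "mass (i # v) = cond (i # v) * level (i # v) powr (p - 1)"
    by (simp add: IH C_def)
  then show ?case using lev IH by simp
qed simp

lemma potential_eq: "potential v = 1 - level v + drop_across v"
  by (induction v) auto

text \<open>
  The conductance of a leaf is its own conductance, so the whole remaining level is used up
  across the leaf.
\<close>

lemma potential_leaf:
  assumes "above_leaves v" "set v \<subseteq> digits" "Q v \<subseteq> G"
  shows "potential v = 1"
proof -
  have c: "cond v = weight v" by (rule cond_leaf[OF assms(3)])
  then have "0 \<le> level v" "mass v = weight v * level v powr (p - 1)"
    using mass_eq_cond_level[OF assms(1,2)] weight_pos[of v] by auto
  then have "drop_across v = level v"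
    using weight_pos[of v] p_gt_1 by (simp add: drop_across_def powr_powr)
  then show ?thesis by (simp add: potential_eq)
qed

lemma dist_Q:
  assumes "x \<in> Q v" "y \<in> Q v"
  shows "dist x y \<le> real DIM('a) * side v"
proof -
  have "dist x y \<le> (\<Sum>b\<in>Basis. \<bar>(x - y) \<bullet> b\<bar>)"
    by (simp add: dist_norm norm_le_l1)
  also have "\<dots> \<le> (\<Sum>b\<in>(Basis::'a set). side v)"
  proof (rule sum_mono)
    fix b :: 'a assume "b \<in> Basis"
    then show "\<bar>(x - y) \<bullet> b\<bar> \<le> side v"
      using assms by (fastforce simp: Q_def mem_cube inner_diff_left)
  qed
  finally show ?thesis by simp
qed

lemma side_tendsto_0: "(\<lambda>k. c * (l0 / 2 ^ k)) \<longlonglongrightarrow> 0"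
  using tendsto_mult[OF tendsto_const[of "c * l0"] LIMSEQ_power_zero[of "1/2 :: real"]]
  by (simp add: power_divide)

lemma leaf_above:
  "\<not> above_leaves v \<Longrightarrow> \<exists>u. length u < length v \<and> set u \<subseteq> set v \<and> Q v \<subseteq> Q u \<and> Q u \<subseteq> G"
proof (induction v)
  case (Cons i v)
  show ?case
  proof (cases "Q v \<subseteq> G")
    case True
    then show ?thesis using Q_Cons_subset by (intro exI[of _ v]) auto
  next
    case False
    with Cons obtain u where "length u < length v" "set u \<subseteq> set v" "Q v \<subseteq> Q u" "Q u \<subseteq> G" by auto
    then show ?thesis using Q_Cons_subset[of i v] by (intro exI[of _ u]) auto
  qed
qed simp

text \<open>
  Small cubes of the branch through a point of the open set \<open>G\<close> are contained in \<open>G\<close>; the first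
  cube of the branch with this property is the leaf.
\<close>

lemma ex_leaf:
  assumes "open G" "x \<in> G" "x \<in> Q []"
  shows "\<exists>v. above_leaves v \<and> set v \<subseteq> digits \<and> Q v \<subseteq> G \<and> x \<in> Q v"
proof -
  have path: "\<exists>v. length v = k \<and> set v \<subseteq> digits \<and> x \<in> Q v" for k
  proof (induction k)
    case (Suc k)
    then obtain v where "length v = k" "set v \<subseteq> digits" "x \<in> Q v" by auto
    moreover from this obtain i where "i \<in> digits" "x \<in> Q (i # v)"
      using Q_children by blast
    ultimately show ?case by (intro exI[of _ "i # v"]) auto
  qed (use assms in auto)
  from assms obtain e where e: "0 < e" "ball x e \<subseteq> G"
    by (auto simp: open_contains_ball)
  have "eventually (\<lambda>k. real DIM('a) * (l0 / 2 ^ k) < e) sequentially"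
    using order_tendstoD(2)[OF side_tendsto_0 e(1)] .
  then obtain k where k: "real DIM('a) * (l0 / 2 ^ k) < e"
    using eventually_happens'[OF sequentially_bot] by blast
  obtain v where v: "length v = k" "set v \<subseteq> digits" "x \<in> Q v" using path by blast
  have "Q v \<subseteq> ball x e"
    using dist_Q[OF v(3)] k v(1) by (fastforce simp: side_def)
  with e have "Q v \<subseteq> G" by blast
  with v(2,3) show ?thesis
  proof (induction v rule: measure_induct_rule[where f = length])
    case (less v)
    then show ?case
      using leaf_above[of v] by (cases "above_leaves v") (blast, meson subset_trans subsetD)
  qed
qed

end

section \<open>Random descents in a tree\<close>

text \<open>
  The argument \<open>\<omega>\<close> chooses a child at every vertex of the tree, also at those that the descent does
  not visit. With independent choices the probability of visiting a vertex is then a finite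
  product over its ancestors.
\<close>

primrec node :: "nat \<Rightarrow> (nat list \<Rightarrow> nat) \<Rightarrow> nat list" where
  "node 0 \<omega> = []"
| "node (Suc k) \<omega> = \<omega> (node k \<omega>) # node k \<omega>"

primrec tails :: "nat list \<Rightarrow> nat list set" where
  "tails [] = {}"
| "tails (i # v) = insert v (tails v)"

text \<open>
  The choice that has to be made at the ancestors of a word in order to reach it; \<open>0\<close> elsewhere.
\<close>

primrec choice_at :: "nat list \<Rightarrow> nat list \<Rightarrow> nat" where
  "choice_at [] = (\<lambda>_. 0)"
| "choice_at (i # v) = (choice_at v)(v := i)"

primrec path_prob :: "(nat list \<Rightarrow> nat pmf) \<Rightarrow> nat list \<Rightarrow> real" where
  "path_prob K [] = 1"
| "path_prob K (i # v) = path_prob K v * pmf (K v) i"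

lemma tails_length: "s \<in> tails v \<Longrightarrow> length s < length v"
  by (induction v) auto

lemma self_notin_tails: "v \<notin> tails v"
  using tails_length by blast

lemma finite_tails: "finite (tails v)"
  by (induction v) auto

lemma length_node [simp]: "length (node k \<omega>) = k"
  by (induction k) auto

lemma node_eq_iff: "node (length v) \<omega> = v \<longleftrightarrow> (\<forall>s\<in>tails v. \<omega> s = choice_at v s)"
proof (induction v)
  case (Cons i v)
  have "(\<forall>s\<in>tails v. \<omega> s = choice_at (i # v) s) \<longleftrightarrow> (\<forall>s\<in>tails v. \<omega> s = choice_at v s)"
    using self_notin_tails[of v] by auto
  then show ?case using Cons by auto
qed simp

abbreviation descent_measure :: "(nat list \<Rightarrow> nat pmf) \<Rightarrow> (nat list \<Rightarrow> nat) measure" where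
  "descent_measure K \<equiv> PiM UNIV (\<lambda>v. measure_pmf (K v))"

text \<open>
  The event is a cylinder that prescribes the choices at the finitely many proper tails of the
  word, which are distinct coordinates.
\<close>

lemma emeasure_descent:
  "emeasure (descent_measure K) {\<omega>. node (length v) \<omega> = v} = ennreal (path_prob K v)"
proof -
  interpret product_prob_space "\<lambda>v. measure_pmf (K v)" UNIV
    by (intro product_prob_spaceI prob_space_measure_pmf)
  have "{\<omega>. node (length v) \<omega> = v}
      = prod_emb UNIV (\<lambda>v. measure_pmf (K v)) (tails v) (\<Pi>\<^sub>E s\<in>tails v. {choice_at v s})"
    by (auto simp: node_eq_iff prod_emb_def PiE_iff)
  then have "emeasure (descent_measure K) {\<omega>. node (length v) \<omega> = v}
      = (\<Prod>s\<in>tails v. emeasure (measure_pmf (K s)) {choice_at v s})"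
    using emeasure_PiM_emb[OF subset_UNIV finite_tails, of v "\<lambda>s. {choice_at v s}"] by simp
  also have "\<dots> = ennreal (path_prob K v)"
  proof (induction v)
    case (Cons i v)
    have "(\<Prod>s\<in>tails v. emeasure (measure_pmf (K s)) {choice_at (i # v) s})
        = (\<Prod>s\<in>tails v. emeasure (measure_pmf (K s)) {choice_at v s})"
      using self_notin_tails[of v] by (intro prod.cong) auto
    then show ?case
      using Cons self_notin_tails[of v]
      by (simp add: finite_tails emeasure_pmf_single ennreal_mult'' mult.commute)
  qed simp
  finally show ?thesis .
qed

lemma measurable_node [measurable]: "node k \<in> measurable (descent_measure K) (count_space UNIV)"
proof (induction k)
  case 0
  then show ?case by (simp add: measurable_const)
next
  case (Suc k)
  have "(\<lambda>\<omega>. \<omega> v # v) \<in> measurable (descent_measure K) (count_space UNIV)" for v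
  proof -
    have "(\<lambda>\<omega>. \<omega> v) \<in> measurable (descent_measure K) (measure_pmf (K v))"
      by (rule measurable_component_singleton) auto
    then show ?thesis
      by (rule measurable_compose) simp
  qed
  then show ?case
    using measurable_compose_countable[OF _ Suc, of "\<lambda>v \<omega>. \<omega> v # v"] by simp
qed

context dyadic_tree
begin

text \<open>
  Where no child has positive conductance no flow arrives, and the choice is arbitrary.
\<close>

definition choice :: "nat list \<Rightarrow> nat pmf" where
  "choice v = (if (\<Sum>j\<in>digits. cond (j # v)) = 0 then return_pmf 0
     else embed_pmf (\<lambda>i. if i \<in> digits then cond (i # v) / (\<Sum>j\<in>digits. cond (j # v)) else 0))"

lemma pmf_choice:
  assumes "(\<Sum>j\<in>digits. cond (j # v)) \<noteq> 0" "i \<in> digits"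
  shows "pmf (choice v) i = cond (i # v) / (\<Sum>j\<in>digits. cond (j # v))"
proof -
  let ?S = "\<Sum>j\<in>digits. cond (j # v)"
  let ?f = "\<lambda>i. if i \<in> digits then cond (i # v) / ?S else 0"
  have S: "0 \<le> ?S" by (intro sum_nonneg cond_nonneg)
  have "(\<integral>\<^sup>+ i. ennreal (?f i) \<partial>count_space UNIV) = (\<Sum>i\<in>digits. ennreal (?f i))"
    by (rule nn_integral_count_space') (auto simp: finite_digits)
  also have "\<dots> = ennreal (\<Sum>i\<in>digits. ?f i)"
    using S cond_nonneg by (intro sum_ennreal) auto
  also have "(\<Sum>i\<in>digits. ?f i) = ?S / ?S"
    unfolding sum_divide_distrib by (intro sum.cong) auto
  also have "\<dots> = 1" using assms by simp
  finally have "(\<integral>\<^sup>+ i. ennreal (?f i) \<partial>count_space UNIV) = 1" by simp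
  then show ?thesis
    using assms S cond_nonneg by (simp add: choice_def pmf_embed_pmf)
qed

text \<open>
  At a vertex whose children all have conductance \<open>0\<close> the mass below is \<open>0\<close>, whereas the
  descent still chooses a child.
\<close>

lemma mass_le_path_prob:
  "set v \<subseteq> digits \<Longrightarrow> mass v \<le> cond [] * path_prob choice v"
proof (induction v)
  case (Cons i v)
  let ?S = "\<Sum>j\<in>digits. cond (j # v)"
  show ?case
  proof (cases "?S = 0")
    case True
    have "0 \<le> path_prob choice u" for u by (induction u) auto
    then have "0 \<le> cond [] * path_prob choice (i # v)"
      by (intro mult_nonneg_nonneg cond_nonneg)
    then show ?thesis by (simp add: True)
  next
    case False
    then have "pmf (choice v) i = cond (i # v) / ?S"
      using Cons.prems by (intro pmf_choice) auto
    then show ?thesis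
      using Cons mult_right_mono[of "mass v" "cond [] * path_prob choice v" "pmf (choice v) i"]
        pmf_nonneg[of "choice v" i]
      by (simp add: mult.assoc del: times_divide_eq_right pmf_nonneg)
  qed
qed simp

lemma corner_in_Q: "corner v \<in> Q v"
  using side_pos[of v] by (simp add: Q_def mem_cube)

definition descent_point :: "(nat list \<Rightarrow> nat) \<Rightarrow> 'a" where
  "descent_point \<omega> = lim (\<lambda>k. corner (node k \<omega>))"

lemma corner_node_in_Q: "k \<le> j \<Longrightarrow> corner (node j \<omega>) \<in> Q (node k \<omega>)"
proof -
  have "Q (node (k + d) \<omega>) \<subseteq> Q (node k \<omega>)" for d
    using Q_Cons_subset by (induction d) fastforce+
  then show "k \<le> j \<Longrightarrow> ?thesis"
    using corner_in_Q by (metis le_Suc_ex subsetD)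
qed

lemma corner_node_tendsto: "(\<lambda>k. corner (node k \<omega>)) \<longlonglongrightarrow> descent_point \<omega>"
proof -
  have "Cauchy (\<lambda>k. corner (node k \<omega>))"
  proof (rule metric_CauchyI)
    fix e :: real assume e: "0 < e"
    have "eventually (\<lambda>k. real DIM('a) * (l0 / 2 ^ k) < e) sequentially"
      using order_tendstoD(2)[OF side_tendsto_0 e] .
    then obtain k where k: "real DIM('a) * (l0 / 2 ^ k) < e"
      using eventually_happens'[OF sequentially_bot] by blast
    have "dist (corner (node i \<omega>)) (corner (node j \<omega>)) < e" if "k \<le> i" "k \<le> j" for i j
      using dist_Q[OF corner_node_in_Q[OF that(1)] corner_node_in_Q[OF that(2)], of \<omega>] k
      unfolding side_def length_node by simp
    then show "\<exists>M. \<forall>m\<ge>M. \<forall>n\<ge>M. dist (corner (node m \<omega>)) (corner (node n \<omega>)) < e" by blast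
  qed
  then show ?thesis
    unfolding descent_point_def using Cauchy_convergent convergent_LIMSEQ_iff by blast
qed

lemma descent_point_in_Q: "descent_point \<omega> \<in> Q (node k \<omega>)"
proof (rule Lim_in_closed_set[OF _ _ _ corner_node_tendsto])
  show "closed (Q (node k \<omega>))" by (simp add: Q_def compact_cube compact_imp_closed)
  show "eventually (\<lambda>j. corner (node j \<omega>) \<in> Q (node k \<omega>)) sequentially"
    using corner_node_in_Q by (auto simp: eventually_sequentially)
qed auto

text \<open>
  The limit point of a descent lies in every closed cube that the descent visits. This gives
  the lower bound also for the part of the flow that never reaches a leaf.
\<close>

lemma ex_equilibrium_measure:
  "\<exists>\<mu>. sets \<mu> = sets borel \<and> emeasure \<mu> UNIV = ennreal (cond [])
    \<and> (\<forall>v. set v \<subseteq> digits \<longrightarrow> ennreal (mass v) \<le> emeasure \<mu> (Q v))"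
proof -
  let ?P = "descent_measure choice"
  interpret product_prob_space "\<lambda>v. measure_pmf (choice v)" UNIV
    by (intro product_prob_spaceI prob_space_measure_pmf)
  have [measurable]: "descent_point \<in> borel_measurable ?P"
  proof (rule borel_measurable_LIMSEQ_metric[OF _ corner_node_tendsto])
    show "(\<lambda>\<omega>. corner (node k \<omega>)) \<in> borel_measurable ?P" for k
      by (rule measurable_compose[OF measurable_node]) simp
  qed
  define \<mu> where "\<mu> = scale_measure (ennreal (cond [])) (distr ?P borel descent_point)"
  have sets: "sets \<mu> = sets borel" by (simp add: \<mu>_def)
  have "emeasure \<mu> UNIV = ennreal (cond []) * emeasure ?P (space ?P)"
    by (simp add: \<mu>_def emeasure_distr)
  also have "emeasure ?P (space ?P) = 1" by (rule P.emeasure_space_1)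
  finally have tot: "emeasure \<mu> UNIV = ennreal (cond [])" by simp
  have "ennreal (mass v) \<le> emeasure \<mu> (Q v)" if "set v \<subseteq> digits" for v
  proof -
    have Q[measurable]: "Q v \<in> sets borel" by (simp add: Q_def cube_def)
    have "ennreal (mass v) \<le> ennreal (cond [] * path_prob choice v)"
      using mass_le_path_prob[OF that] by (intro ennreal_leI)
    also have "\<dots> = ennreal (cond []) * emeasure ?P {\<omega>. node (length v) \<omega> = v}"
      using cond_nonneg by (simp add: emeasure_descent ennreal_mult')
    also have "\<dots> \<le> ennreal (cond []) * emeasure ?P (descent_point -` Q v \<inter> space ?P)"
    proof (intro mult_left_mono emeasure_mono)
      show "{\<omega>. node (length v) \<omega> = v} \<subseteq> descent_point -` Q v \<inter> space ?P"
        using descent_point_in_Q[of _ "length v"] by (auto simp: space_PiM) metis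
    qed auto
    also have "\<dots> = emeasure \<mu> (Q v)" by (simp add: \<mu>_def emeasure_distr)
    finally show ?thesis .
  qed
  with sets tot show ?thesis by blast
qed

end

section \<open>The Wolff potential along a branch of the tree\<close>

lemma ennreal_powr_mono:
  assumes "a \<le> b" "0 \<le> s"
  shows "ennreal_powr a s \<le> ennreal_powr b s"
proof (cases "b = \<infinity>")
  case False
  then have "a \<noteq> \<infinity>" using assms(1) by (auto simp: top_unique)
  then show ?thesis
    using False assms by (auto simp: ennreal_powr_def less_top enn2real_mono intro!: ennreal_leI powr_mono2)
qed (simp add: ennreal_powr_def)

lemma ennreal_powr_ennreal: "0 \<le> a \<Longrightarrow> ennreal_powr (ennreal a) s = ennreal (a powr s)"
  by (simp add: ennreal_powr_def)

lemma inverse_antimono_ennreal: "a \<le> b \<Longrightarrow> inverse b \<le> inverse (a :: ennreal)"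
  including ennreal.lifting by transfer (rule ereal_inverse_antimono)

context dyadic_tree
begin

definition wolff_const :: real where
  "wolff_const = (2 * real DIM('a)) powr (- (real DIM('a) - p) / (p - 1)) / 2"

lemma wolff_const_pos: "0 < wolff_const"
  by (simp add: wolff_const_def)

definition radii :: "nat list \<Rightarrow> real set" where
  "radii v = {real DIM('a) * side v <..< 2 * real DIM('a) * side v}"

text \<open>
  The integrand of the Wolff potential decreases in the radius once the mass of the ball is
  replaced by a constant; this is the resulting lower bound at the outer end of \<open>radii v\<close>.
\<close>

definition radial_density :: "real \<Rightarrow> nat list \<Rightarrow> real" where
  "radial_density c v = 2 * wolff_const * c powr (1 / (p - 1)) * drop_across v / (2 * real DIM('a) * side v)"

text \<open>
  A step function of the radius below the integrand of the Wolff potential. Each cube of the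
  branch contributes on the radii for which the ball certainly contains it; for different cubes
  of one branch these intervals are disjoint. The comparison with a step function
  keeps the integrand of the Wolff potential out of all questions of measurability.
\<close>

primrec radial_step :: "real \<Rightarrow> nat list \<Rightarrow> real \<Rightarrow> ennreal" where
  "radial_step c [] t = ennreal (radial_density c []) * indicator (radii []) t"
| "radial_step c (i # v) t = radial_step c v t + ennreal (radial_density c (i # v)) * indicator (radii (i # v)) t"

lemma drop_across_nonneg: "0 \<le> drop_across v"
  by (simp add: drop_across_def)

lemma radial_density_nonneg: "0 \<le> radial_density c v"
  using wolff_const_pos side_pos[of v] drop_across_nonneg[of v]
  by (auto simp: radial_density_def)

lemma integral_radial_part:
  "(\<integral>\<^sup>+t. ennreal (radial_density c v) * indicator (radii v) t \<partial>lborel)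
     = ennreal (wolff_const * c powr (1 / (p - 1)) * drop_across v)"
proof -
  have "(\<integral>\<^sup>+t. ennreal (radial_density c v) * indicator (radii v) t \<partial>lborel)
      = ennreal (radial_density c v) * ennreal (real DIM('a) * side v)"
    using side_pos[of v] by (subst nn_integral_cmult_indicator) (auto simp: radii_def mult.commute)
  also have "\<dots> = ennreal (radial_density c v * (real DIM('a) * side v))"
    using radial_density_nonneg side_pos[of v] by (simp add: ennreal_mult')
  also have "radial_density c v * (real DIM('a) * side v)
      = wolff_const * c powr (1 / (p - 1)) * drop_across v"
    using side_pos[of v] by (simp add: radial_density_def field_simps)
  finally show ?thesis .
qed

lemma measurable_radial_step [measurable]: "radial_step c v \<in> borel_measurable borel"
  by (induction v) (auto simp: radii_def)

lemma integral_radial_step: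
  "(\<integral>\<^sup>+t. radial_step c v t \<partial>lborel) = ennreal (wolff_const * c powr (1 / (p - 1)) * potential v)"
proof -
  have pot: "0 \<le> potential v" for v
    using drop_across_nonneg by (induction v) (auto intro: add_nonneg_nonneg)
  show ?thesis
  proof (induction v)
    case Nil
    then show ?case using integral_radial_part[of c "[]"] by simp
  next
    case (Cons i v)
    have "(\<integral>\<^sup>+t. radial_step c (i # v) t \<partial>lborel)
        = (\<integral>\<^sup>+t. radial_step c v t \<partial>lborel)
          + (\<integral>\<^sup>+t. ennreal (radial_density c (i # v)) * indicator (radii (i # v)) t \<partial>lborel)"
      unfolding radial_step.simps
      by (intro nn_integral_add) (auto simp: radii_def)
    also have "\<dots> = ennreal (wolff_const * c powr (1 / (p - 1)) * potential v
          + wolff_const * c powr (1 / (p - 1)) * drop_across (i # v))"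
      unfolding Cons integral_radial_part
      using pot drop_across_nonneg wolff_const_pos
      by (intro ennreal_plus[symmetric] mult_nonneg_nonneg) auto
    finally show ?case by (simp add: algebra_simps)
  qed
qed

lemma radial_step_le:
  assumes p: "p \<le> real DIM('a)" and c: "0 \<le> c"
    and sets: "sets \<mu> = sets borel"
    and mass: "\<And>v. set v \<subseteq> digits \<Longrightarrow> ennreal (c * mass v) \<le> emeasure \<mu> (Q v)"
    and r: "2 * real DIM('a) * l0 \<le> r"
  shows "set v \<subseteq> digits \<Longrightarrow> x \<in> Q v \<Longrightarrow> radial_step c v t \<le>
    ennreal_powr (emeasure \<mu> (ball x t) / ennreal (t powr (real DIM('a) - p))) (1 / (p - 1))
      / ennreal t * indicator {real DIM('a) * side v <..< r} t"
proof (induction v)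
  let ?F = "\<lambda>t. ennreal_powr (emeasure \<mu> (ball x t) / ennreal (t powr (real DIM('a) - p))) (1 / (p - 1)) / ennreal t"
  have part: "ennreal (radial_density c v) \<le> ?F t"
    if v: "set v \<subseteq> digits" "x \<in> Q v" and t: "t \<in> radii v" for v
  proof -
    let ?R = "2 * real DIM('a) * side v"
    have R: "0 < ?R" using side_pos[of v] by simp
    have t0: "0 < t" "t \<le> ?R" "real DIM('a) * side v < t"
      using t side_pos[of v] unfolding radii_def
      by (auto intro: le_less_trans[rotated])
    have sub: "Q v \<subseteq> ball x t"
      using le_less_trans[OF dist_Q[OF v(2)] t0(3)] by auto
    have "ennreal (c * mass v) \<le> emeasure \<mu> (ball x t)"
      by (rule order_trans[OF mass[OF v(1)] emeasure_mono[OF sub]]) (simp add: sets)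
    then have "ennreal (c * mass v) / ennreal (?R powr (real DIM('a) - p))
        \<le> emeasure \<mu> (ball x t) / ennreal (t powr (real DIM('a) - p))"
      unfolding divide_ennreal_def using t0 p R
      by (intro mult_mono inverse_antimono_ennreal ennreal_leI powr_mono2) auto
    then have "ennreal_powr (ennreal (c * mass v / ?R powr (real DIM('a) - p))) (1 / (p - 1))
        \<le> ennreal_powr (emeasure \<mu> (ball x t) / ennreal (t powr (real DIM('a) - p))) (1 / (p - 1))"
      using c mass_nonneg R p_gt_1
      by (intro ennreal_powr_mono) (auto simp: divide_ennreal)
    then have "ennreal ((c * mass v / ?R powr (real DIM('a) - p)) powr (1 / (p - 1))) / ennreal ?R \<le> ?F t"
      unfolding divide_ennreal_def using t0 R c mass_nonneg
      by (subst (asm) ennreal_powr_ennreal)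
        (auto intro!: mult_mono inverse_antimono_ennreal ennreal_leI)
    moreover have "(c * mass v / ?R powr (real DIM('a) - p)) powr (1 / (p - 1)) / ?R = radial_density c v"
    proof -
      define d where "d = 2 * real DIM('a)"
      define e where "e = real DIM('a) - p"
      have "(d * side v) powr e = d powr e * weight v"
        by (simp only: powr_mult weight_def e_def)
      then have "c * mass v / (d * side v) powr e = c * (mass v / weight v) * d powr (- e)"
        by (simp only: powr_minus divide_inverse inverse_mult_distrib mult_ac)
      then have "(c * mass v / (d * side v) powr e) powr (1 / (p - 1))
          = c powr (1 / (p - 1)) * drop_across v * d powr (- e * (1 / (p - 1)))"
        by (simp only: powr_mult drop_across_def powr_powr)
      also have "d powr (- e * (1 / (p - 1))) = 2 * wolff_const"
        by (simp add: wolff_const_def d_def e_def)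
      finally show ?thesis
        unfolding radial_density_def d_def[symmetric] e_def[symmetric]
        by (simp only: mult_ac)
    qed
    ultimately show ?thesis
      using R by (subst (asm) divide_ennreal) auto
  qed
  {
    case Nil
    have "radii [] \<subseteq> {real DIM('a) * side [] <..< r}"
      using r by (auto simp: radii_def side_def)
    then show ?case using part[of "[]"] Nil by (auto simp: indicator_def)
  next
    case (Cons i v)
    have xv: "x \<in> Q v" using Cons.prems Q_Cons_subset by blast
    have IH: "radial_step c v t \<le> ?F t * indicator {real DIM('a) * side v <..< r} t"
      using Cons xv by simp
    have rad: "radii (i # v) = {real DIM('a) * side (i # v) <..< real DIM('a) * side v}"
      by (simp add: radii_def side_Cons)
    have "side v \<le> l0" using l0_pos by (simp add: side_def field_simps)
    then have "real DIM('a) * side v \<le> real DIM('a) * l0" by (intro mult_left_mono) auto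
    then have sv: "real DIM('a) * side v \<le> r"
      using r mult_nonneg_nonneg[of "real DIM('a)" l0] l0_pos by linarith
    have ss: "real DIM('a) * side (i # v) \<le> real DIM('a) * side v"
      using side_pos[of v] by (simp add: side_Cons)
    show ?case
    proof (cases "t \<in> radii (i # v)")
      case True
      then have "radial_step c v t = 0"
        using IH by (simp add: rad)
      moreover have "t \<in> {real DIM('a) * side (i # v) <..< r}"
        using True sv by (auto simp: rad)
      ultimately show ?thesis
        using part[OF Cons.prems True] True by simp
    next
      case False
      have "?F t * indicator {real DIM('a) * side v <..< r} t
          \<le> ?F t * indicator {real DIM('a) * side (i # v) <..< r} t"
        using le_less_trans[OF ss] by (intro mult_left_mono) (auto simp: indicator_def)
      with IH False show ?thesis by (auto intro: order_trans)
    qed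
  }
qed

lemma wolff_ge_on_leaves:
  assumes "p \<le> real DIM('a)" "0 \<le> c" "sets \<mu> = sets borel"
    and "\<And>v. set v \<subseteq> digits \<Longrightarrow> ennreal (c * mass v) \<le> emeasure \<mu> (Q v)"
    and "2 * real DIM('a) * l0 \<le> r" "open G" "x \<in> G" "x \<in> Q []"
  shows "ennreal (wolff_const * c powr (1 / (p - 1))) \<le> wolff \<mu> p x r"
proof -
  obtain v where v: "above_leaves v" "set v \<subseteq> digits" "Q v \<subseteq> G" "x \<in> Q v"
    using ex_leaf assms by blast
  have "ennreal (wolff_const * c powr (1 / (p - 1))) = (\<integral>\<^sup>+t. radial_step c v t \<partial>lborel)"
    using potential_leaf[OF v(1-3)] by (simp add: integral_radial_step)
  also have "\<dots> \<le> wolff \<mu> p x r"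
    unfolding wolff_def
  proof (intro nn_integral_mono order_trans[OF radial_step_le[OF assms(1-5) v(2,4)]] mult_left_mono)
    show "indicator {real DIM('a) * side v <..< r} t \<le> (indicator {0<..<r} t :: ennreal)" for t
      using side_pos[of v] by (auto simp: indicator_def intro: le_less_trans[rotated])
  qed auto
  finally show ?thesis .
qed

end

section \<open>A smooth bump function\<close>

text \<open>
  The functions \<open>t\<^bsup>-m\<^esup> exp (-1/t)\<close>, extended by \<open>0\<close> to \<open>t \<le> 0\<close>, span a space that is closed under
  differentiation. This gives all derivatives of a bump function at once.
\<close>

definition flat_exp :: "nat \<Rightarrow> real \<Rightarrow> real" where
  "flat_exp m t = (if t > 0 then inverse t ^ m * exp (- inverse t) else 0)"

lemma flat_exp_tendsto_0: "(flat_exp m \<longlongrightarrow> 0) (at_right 0)"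
proof -
  have "((\<lambda>t::real. inverse t ^ m / exp (inverse t)) \<longlongrightarrow> 0) (at_right 0)"
    by (rule filterlim_compose[OF tendsto_power_div_exp_0 filterlim_inverse_at_top_right])
  moreover have "eventually (\<lambda>t::real. inverse t ^ m / exp (inverse t) = flat_exp m t) (at_right 0)"
    by (auto simp: eventually_at_right_field flat_exp_def exp_minus divide_inverse intro!: exI[of _ 1])
  ultimately show ?thesis by (rule Lim_transform_eventually)
qed

lemma flat_exp_deriv:
  "(flat_exp m has_real_derivative (flat_exp (m + 2) t - real m * flat_exp (m + 1) t)) (at t)"
proof -
  consider "t > 0" | "t < 0" | "t = 0" by linarith
  then show ?thesis
  proof cases
    case 1
    have pow: "((\<lambda>s. inverse s ^ m) has_real_derivative - real m * inverse t ^ (m + 1)) (at t)"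
    proof (cases m)
      case (Suc k)
      show ?thesis
        unfolding Suc by (rule DERIV_cong[OF DERIV_power_Suc[OF DERIV_inverse]])
          (use 1 in \<open>auto simp: algebra_simps\<close>)
    qed simp
    have "((\<lambda>s. exp (- inverse s)) has_real_derivative inverse t ^ 2 * exp (- inverse t)) (at t)"
      using 1 by (auto intro!: derivative_eq_intros simp: power2_eq_square)
    from DERIV_mult[OF pow this]
    have "((\<lambda>s. inverse s ^ m * exp (- inverse s)) has_real_derivative
        (flat_exp (m + 2) t - real m * flat_exp (m + 1) t)) (at t)"
      using 1 by (simp add: flat_exp_def power_add power2_eq_square algebra_simps)
    then show ?thesis
      by (rule has_field_derivative_transform_within[where d = t])
        (use 1 in \<open>auto simp: flat_exp_def dist_real_def\<close>)
  next
    case 2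
    have "((\<lambda>s. 0) has_real_derivative 0) (at t)" by simp
    then have "(flat_exp m has_real_derivative 0) (at t)"
      by (rule has_field_derivative_transform_within[where d = "- t"])
        (use 2 in \<open>auto simp: flat_exp_def dist_real_def\<close>)
    then show ?thesis using 2 by (simp add: flat_exp_def)
  next
    case 3
    have "((\<lambda>h. (flat_exp m (0 + h) - flat_exp m 0) / h) \<longlongrightarrow> 0) (at 0)"
    proof (rule filterlim_split_at)
      have "eventually (\<lambda>h. 0 = (flat_exp m (0 + h) - flat_exp m 0) / h) (at_left 0)"
        by (auto simp: eventually_at_left_field flat_exp_def intro!: exI[of _ "-1"])
      then show "((\<lambda>h. (flat_exp m (0 + h) - flat_exp m 0) / h) \<longlongrightarrow> 0) (at_left 0)"
        by (rule Lim_transform_eventually[OF tendsto_const])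
      have "eventually (\<lambda>h. flat_exp (Suc m) h = (flat_exp m (0 + h) - flat_exp m 0) / h) (at_right 0)"
        by (auto simp: eventually_at_right_field flat_exp_def divide_inverse intro!: exI[of _ 1])
      then show "((\<lambda>h. (flat_exp m (0 + h) - flat_exp m 0) / h) \<longlongrightarrow> 0) (at_right 0)"
        by (rule Lim_transform_eventually[OF flat_exp_tendsto_0])
    qed
    then have "(flat_exp m has_real_derivative 0) (at 0)"
      by (simp only: DERIV_def)
    then show ?thesis using 3 by (simp add: flat_exp_def)
  qed
qed

text \<open>
  An algebra of functions that contains the bump function and all its directional derivatives.
\<close>

inductive radial_smooth :: "real \<Rightarrow> ('a::euclidean_space \<Rightarrow> real) \<Rightarrow> bool" for c where
  const: "radial_smooth c (\<lambda>x. k)"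
| inner: "radial_smooth c (\<lambda>x. x \<bullet> v)"
| flat: "radial_smooth c (\<lambda>x. flat_exp m (3 - c * (x \<bullet> x)))"
| add: "radial_smooth c f \<Longrightarrow> radial_smooth c g \<Longrightarrow> radial_smooth c (\<lambda>x. f x + g x)"
| mult: "radial_smooth c f \<Longrightarrow> radial_smooth c g \<Longrightarrow> radial_smooth c (\<lambda>x. f x * g x)"

lemma flat_has_derivative:
  "((\<lambda>x. flat_exp m (3 - c * (x \<bullet> x))) has_derivative
     (\<lambda>h. (flat_exp (m + 2) (3 - c * (x \<bullet> x)) - real m * flat_exp (m + 1) (3 - c * (x \<bullet> x)))
        * (- 2 * c * (x \<bullet> h)))) (at (x::'a::euclidean_space))"
proof -
  have "((\<lambda>x. 3 - c * (x \<bullet> x)) has_derivative (\<lambda>h. - 2 * c * (x \<bullet> h))) (at x)"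
    by (auto intro!: derivative_eq_intros simp: inner_commute algebra_simps)
  from has_derivative_compose[OF this flat_exp_deriv[unfolded has_field_derivative_def]]
  show ?thesis by (simp add: mult_ac)
qed

lemma radial_smooth_deriv:
  assumes "radial_smooth c (f :: 'a::euclidean_space \<Rightarrow> real)"
  shows "\<exists>f'. (\<forall>x. (f has_derivative f' x) (at x)) \<and> (\<forall>v. radial_smooth c (\<lambda>x. f' x v))"
  using assms
proof induction
  case (const k)
  show ?case by (intro exI[of _ "\<lambda>_ _. 0"]) (auto intro: radial_smooth.const)
next
  case (inner v)
  show ?case
    by (intro exI[of _ "\<lambda>_ h. h \<bullet> v"]) (auto intro: radial_smooth.const derivative_intros)
next
  case (flat m)
  let ?f' = "\<lambda>x h. (flat_exp (m + 2) (3 - c * (x \<bullet> x)) - real m * flat_exp (m + 1) (3 - c * (x \<bullet> x)))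
        * (- 2 * c * (x \<bullet> h))"
  have "radial_smooth c (\<lambda>x. ?f' x v)" for v :: 'a
  proof -
    have "radial_smooth c (\<lambda>x::'a. (flat_exp (m + 2) (3 - c * (x \<bullet> x))
        + (- real m) * flat_exp (m + 1) (3 - c * (x \<bullet> x))) * ((- 2 * c) * (x \<bullet> v)))"
      by (intro radial_smooth.intros)
    then show ?thesis by simp
  qed
  then show ?case
    by (intro exI[of _ ?f'] conjI allI flat_has_derivative)
next
  case (add f g)
  then obtain f' g' where "\<forall>x. (f has_derivative f' x) (at x)" "\<forall>v. radial_smooth c (\<lambda>x. f' x v)"
    "\<forall>x. (g has_derivative g' x) (at x)" "\<forall>v. radial_smooth c (\<lambda>x. g' x v)" by blast
  then show ?case
    by (intro exI[of _ "\<lambda>x h. f' x h + g' x h"]) (auto intro: radial_smooth.intros derivative_intros)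
next
  case (mult f g)
  then obtain f' g' where *: "\<forall>x. (f has_derivative f' x) (at x)" "\<forall>v. radial_smooth c (\<lambda>x. f' x v)"
    "\<forall>x. (g has_derivative g' x) (at x)" "\<forall>v. radial_smooth c (\<lambda>x. g' x v)" by blast
  then have "radial_smooth c (\<lambda>x. f x * g' x v + f' x v * g x)" for v
    using mult.hyps by (intro radial_smooth.add radial_smooth.mult) auto
  moreover have "((\<lambda>x. f x * g x) has_derivative (\<lambda>h. f x * g' x h + f' x h * g x)) (at x)" for x
    by (intro has_derivative_mult) (use * in auto)
  ultimately show ?case
    by (intro exI[of _ "\<lambda>x h. f x * g' x h + f' x h * g x"]) auto
qed

lemma radial_smooth_Ck: "radial_smooth c f \<Longrightarrow> Ck k f"
proof (induction k arbitrary: f)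
  case 0
  then show ?case
    using radial_smooth_deriv[OF 0] has_derivative_continuous continuous_at_imp_continuous_on
    by (metis Ck.simps(1))
next
  case (Suc k)
  then obtain f' where f': "\<And>x. (f has_derivative f' x) (at x)" "\<And>v. radial_smooth c (\<lambda>x. f' x v)"
    using radial_smooth_deriv by blast
  then have "frechet_derivative f (at x) = f' x" for x
    using frechet_derivative_at by metis
  then show ?case
    using f' Suc.IH by (auto simp: differentiable_def)
qed

section \<open>The capacity of a sphere\<close>

lemma flat_exp_2_le: "0 \<le> flat_exp 2 t \<and> flat_exp 2 t \<le> 2"
proof (cases "t > 0")
  case True
  define y where "y = inverse t"
  have y: "0 < y" using True by (simp add: y_def)
  have "1 + y + y\<^sup>2 / 2 \<le> exp y" using exp_lower_Taylor_quadratic[of y] y by simp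
  then have "y\<^sup>2 \<le> 2 * exp y" using y by (simp add: field_simps)
  then have "y\<^sup>2 * exp (- y) \<le> 2"
    by (simp add: exp_minus field_simps)
  then show ?thesis using True by (simp add: flat_exp_def y_def)
qed (simp add: flat_exp_def)

definition sphere_cap_const :: "nat \<Rightarrow> real \<Rightarrow> real" where
  "sphere_cap_const n p = (8 * exp (1 / 2)) powr p * unit_ball_vol (real n) * 2 ^ n"

text \<open>
  The test function is a smooth bump that equals \<open>1\<close> on the sphere, vanishes for
  \<open>|x| \<ge> sqrt 3 * \<rho>\<close> and has a gradient of size at most a multiple of \<open>1 / \<rho>\<close>.
\<close>

lemma cap_sphere_le:
  fixes \<rho> p :: real
  assumes "0 < \<rho>" "1 < p"
  shows "cap p (sphere (0::'a::euclidean_space) \<rho>) (ball 0 (2 * \<rho>))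
    \<le> ennreal (sphere_cap_const DIM('a) p * \<rho> powr (real DIM('a) - p))"
proof -
  let ?c = "1 / \<rho>\<^sup>2" and ?O = "ball (0::'a) (2 * \<rho>)"
  define u where "u x = exp (1 / 2) * flat_exp 0 (3 - ?c * (x \<bullet> x))" for x :: 'a
  have rs: "radial_smooth ?c u"
    unfolding u_def by (intro radial_smooth.intros)
  have supp: "closure {x. u x \<noteq> 0} \<subseteq> cball 0 (sqrt 3 * \<rho>)"
  proof (rule closure_minimal)
    show "{x. u x \<noteq> 0} \<subseteq> cball 0 (sqrt 3 * \<rho>)"
    proof
      fix x assume "x \<in> {x. u x \<noteq> 0}"
      then have "?c * (x \<bullet> x) < 3" by (auto simp: u_def flat_exp_def split: if_splits)
      then have "(norm x)\<^sup>2 \<le> (sqrt 3 * \<rho>)\<^sup>2"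
        using assms by (simp add: field_simps power2_norm_eq_inner power_mult_distrib)
      then show "x \<in> cball 0 (sqrt 3 * \<rho>)"
        using assms power2_le_imp_le[of "norm x" "sqrt 3 * \<rho>"] by simp
    qed
  qed simp
  have "sqrt 3 < 2" by (rule real_less_lsqrt) auto
  then have "sqrt 3 * \<rho> < 2 * \<rho>" using assms by simp
  then have "cball 0 (sqrt 3 * \<rho>) \<subseteq> ?O" by auto
  moreover have "compact (closure {x. u x \<noteq> 0})"
    using supp by (meson bounded_cball bounded_subset compact_closure bounded_closure closed_closure compact_eq_bounded_closed)
  ultimately have tf: "test_function ?O u"
    using supp radial_smooth_Ck[OF rs] by (auto simp: test_function_def)
  have one: "1 \<le> u x" if "x \<in> sphere 0 \<rho>" for x
  proof -
    have "?c * (x \<bullet> x) = 1" using that assms by (simp add: power2_norm_eq_inner[symmetric])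
    then show ?thesis by (simp add: u_def flat_exp_def exp_add[symmetric])
  qed
  have gr: "norm (grad u x) \<le> 8 * exp (1 / 2) / \<rho>" if x: "x \<in> ?O" for x
  proof -
    define k where "k = exp (1 / 2) * flat_exp 2 (3 - ?c * (x \<bullet> x)) * (- 2 * ?c)"
    have "(u has_derivative (\<lambda>h. exp (1 / 2) * (flat_exp 2 (3 - ?c * (x \<bullet> x)) * (- 2 * ?c * (x \<bullet> h))))) (at x)"
      unfolding u_def using flat_has_derivative[of 0 ?c x] by (intro has_derivative_mult_right) (simp add: numeral_2_eq_2)
    then have "GDERIV u x :> k *\<^sub>R x"
      unfolding gderiv_def by (rule has_derivative_eq_rhs) (auto simp: k_def inner_commute fun_eq_iff)
    then have "grad u x = k *\<^sub>R x"
      unfolding grad_def by (intro the_equality) (auto intro: GDERIV_unique)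
    then have "norm (grad u x) = \<bar>k\<bar> * norm x" by simp
    also have "\<dots> \<le> (exp (1 / 2) * 2 * (2 * ?c)) * (2 * \<rho>)"
    proof (intro mult_mono)
      have "\<bar>k\<bar> = exp (1 / 2) * flat_exp 2 (3 - ?c * (x \<bullet> x)) * (2 * ?c)"
        using flat_exp_2_le[of "3 - ?c * (x \<bullet> x)"] by (simp add: k_def abs_mult)
      also have "\<dots> \<le> exp (1 / 2) * 2 * (2 * ?c)"
        using flat_exp_2_le by (intro mult_right_mono mult_left_mono) auto
      finally show "\<bar>k\<bar> \<le> exp (1 / 2) * 2 * (2 * ?c)" .
    qed (use x in auto)
    also have "\<dots> = 8 * exp (1 / 2) / \<rho>"
      using assms by (simp add: field_simps power2_eq_square)
    finally show ?thesis .
  qed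
  have "cap p (sphere 0 \<rho>) ?O = cap_compact p (sphere 0 \<rho>) ?O"
    using assms by (intro cap_eq_cap_compact) auto
  also have "\<dots> \<le> (\<integral>\<^sup>+ x\<in>?O. ennreal (norm (grad u x) powr p) \<partial>lborel)"
    unfolding cap_compact_def using tf one by (intro INF_lower) auto
  also have "\<dots> \<le> (\<integral>\<^sup>+ x\<in>?O. ennreal ((8 * exp (1 / 2) / \<rho>) powr p) \<partial>lborel)"
    using gr assms by (intro nn_integral_mono) (auto simp: indicator_def intro!: ennreal_leI powr_mono2)
  also have "\<dots> = ennreal ((8 * exp (1 / 2) / \<rho>) powr p) * emeasure lborel ?O"
    by (rule nn_integral_cmult_indicator) auto
  also have "\<dots> = ennreal ((8 * exp (1 / 2) / \<rho>) powr p * (unit_ball_vol (real DIM('a)) * (2 * \<rho>) ^ DIM('a)))"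
    using assms by (subst emeasure_ball) (auto simp: ennreal_mult')
  also have "(8 * exp (1 / 2) / \<rho>) powr p * (unit_ball_vol (real DIM('a)) * (2 * \<rho>) ^ DIM('a))
      = sphere_cap_const DIM('a) p * \<rho> powr (real DIM('a) - p)"
    using assms
    by (simp add: sphere_cap_const_def powr_divide power_mult_distrib powr_diff powr_realpow)
  finally show ?thesis .
qed

section \<open>Weights growing to infinity and countable sums of measures\<close>

text \<open>
  With the tails \<open>r\<^sub>j\<close> of the series, \<open>b\<^sub>j = r\<^sub>j - r\<^sub>j\<^sub>+\<^sub>1\<close>, and the weights \<open>1 / sqrt r\<^sub>j\<close> turn the series
  into one dominated by a telescoping series of square roots.
\<close>

lemma ex_divergent_weights:
  fixes b :: "nat \<Rightarrow> real"
  assumes "summable b" "\<And>j. 0 < b j"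
  shows "\<exists>\<beta>. (\<forall>j. 0 < \<beta> j) \<and> filterlim \<beta> at_top sequentially \<and> summable (\<lambda>j. \<beta> j * b j)"
proof -
  define r where "r j = (\<Sum>k. b (k + j))" for j
  have sm: "summable (\<lambda>k. b (k + j))" for j
    using assms(1) by (simp add: summable_iff_shift)
  have r_pos: "0 < r j" for j
    unfolding r_def by (intro suminf_pos sm assms(2))
  have step: "r j - r (Suc j) = b j" for j
    using suminf_split_head[OF sm[of j]] by (simp add: r_def)
  have r0: "r \<longlonglongrightarrow> 0"
    unfolding r_def by (rule suminf_exist_split2[OF assms(1)])
  have sq0: "(\<lambda>j. sqrt (r j)) \<longlonglongrightarrow> 0"
    using tendsto_real_sqrt[OF r0] by simp
  define \<beta> where "\<beta> j = inverse (sqrt (r j))" for j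
  have pos: "0 < \<beta> j" for j using r_pos by (simp add: \<beta>_def field_simps)
  moreover have "filterlim \<beta> at_top sequentially"
    unfolding \<beta>_def
    by (rule filterlim_inverse_at_top[OF sq0]) (simp add: r_pos)
  moreover have "summable (\<lambda>j. \<beta> j * b j)"
  proof (rule summable_comparison_test')
    show "summable (\<lambda>j. 2 * (sqrt (r j) - sqrt (r (Suc j))))"
      by (intro summable_mult telescope_summable'[OF sq0])
    fix j
    have le: "sqrt (r (Suc j)) \<le> sqrt (r j)"
      using step[of j] assms(2)[of j] by simp
    have "b j = (sqrt (r j) - sqrt (r (Suc j))) * (sqrt (r j) + sqrt (r (Suc j)))"
      using r_pos[of j] r_pos[of "Suc j"] by (simp add: step[symmetric] algebra_simps)
    also have "\<dots> \<le> (sqrt (r j) - sqrt (r (Suc j))) * (2 * sqrt (r j))"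
      using le by (intro mult_left_mono) auto
    finally have "\<beta> j * b j \<le> \<beta> j * ((sqrt (r j) - sqrt (r (Suc j))) * (2 * sqrt (r j)))"
      using pos[of j] by (intro mult_left_mono) auto
    also have "\<dots> = 2 * (sqrt (r j) - sqrt (r (Suc j)))"
      using r_pos[of j] by (simp add: \<beta>_def field_simps)
    finally show "norm (\<beta> j * b j) \<le> 2 * (sqrt (r j) - sqrt (r (Suc j)))"
      using pos[of j] assms(2)[of j] by simp
  qed
  ultimately show ?thesis by blast
qed

lemma ex_sum_measure:
  fixes \<mu> :: "nat \<Rightarrow> 'a::euclidean_space measure" and c :: "nat \<Rightarrow> ennreal"
  assumes "\<And>j. sets (\<mu> j) = sets borel"
  shows "\<exists>M. sets M = sets borel \<and> (\<forall>A\<in>sets borel. emeasure M A = (\<Sum>j. c j * emeasure (\<mu> j) A))"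
proof -
  define M where "M = measure_of UNIV (sets borel) (\<lambda>A. \<Sum>j. c j * emeasure (\<mu> j) A)"
  have sets: "sets M = sets (borel :: 'a measure)"
    unfolding M_def using sets.sigma_sets_eq[of "borel :: 'a measure"] by (simp add: sets_measure_of)
  have "emeasure M A = (\<Sum>j. c j * emeasure (\<mu> j) A)" if A: "A \<in> sets borel" for A
  proof (rule emeasure_measure_of[OF M_def])
    show "sets borel \<subseteq> Pow (UNIV :: 'a set)" by simp
    show "positive (sets M) (\<lambda>A. \<Sum>j. c j * emeasure (\<mu> j) A)"
      by (simp add: positive_def)
    show "countably_additive (sets M) (\<lambda>A. \<Sum>j. c j * emeasure (\<mu> j) A)"
    proof (rule countably_additiveI)
      fix B :: "nat \<Rightarrow> 'a set"
      assume B: "range B \<subseteq> sets M" "disjoint_family B"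
      have "(\<Sum>i. \<Sum>j. c j * emeasure (\<mu> j) (B i)) = (\<Sum>j. \<Sum>i. c j * emeasure (\<mu> j) (B i))"
        using nn_integral_suminf[of "\<lambda>j i. c j * emeasure (\<mu> j) (B i)" "count_space UNIV"]
        by (simp add: nn_integral_count_space_nat)
      also have "\<dots> = (\<Sum>j. c j * emeasure (\<mu> j) (\<Union>i. B i))"
        using B assms by (simp add: suminf_emeasure sets)
      finally show "(\<Sum>i. \<Sum>j. c j * emeasure (\<mu> j) (B i)) = (\<Sum>j. c j * emeasure (\<mu> j) (\<Union>i. B i))" .
    qed
    show "A \<in> sets M" using A sets by simp
  qed
  with sets show ?thesis by blast
qed

section \<open>Measures with large Wolff potential on a set of small capacity\<close>

lemma test_function_derivative:
  assumes "test_function \<Omega> u"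
  shows "(u has_derivative (\<lambda>h. grad u x \<bullet> h)) (at x)"
proof -
  have "u differentiable at x"
    using assms Ck_differentiable unfolding test_function_def by blast
  from GDERIV_grad[OF this] show ?thesis
    unfolding gderiv_def by (rule has_derivative_eq_rhs) (simp add: inner_commute)
qed

lemma test_function_continuous_grad:
  fixes u :: "'a::euclidean_space \<Rightarrow> real"
  assumes "test_function \<Omega> u"
  shows "continuous_on UNIV (grad u)"
  unfolding continuous_on_componentwise[of UNIV "grad u"]
proof
  fix b :: 'a
  have "frechet_derivative u (at x) b = grad u x \<bullet> b" for x
    using frechet_derivative_at[OF test_function_derivative[OF assms, of x]] by metis
  moreover have "Ck 0 (\<lambda>x. frechet_derivative u (at x) b)"
    using assms unfolding test_function_def by (metis Ck.simps(2))
  ultimately show "continuous_on UNIV (\<lambda>x. grad u x \<bullet> b)" by simp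
qed

lemma test_function_outside:
  fixes u :: "'a::euclidean_space \<Rightarrow> real"
  assumes "test_function \<Omega> u" "x \<notin> \<Omega>"
  shows "u x = 0" "grad u x = 0"
proof -
  let ?S = "closure {x. u x \<noteq> 0}"
  have x: "x \<in> - ?S" using assms by (auto simp: test_function_def)
  have zero: "u y = 0" if "y \<in> - ?S" for y
    using that closure_subset[of "{x. u x \<noteq> 0}"] by auto
  from zero[OF x] show "u x = 0" .
  have "((\<lambda>_. 0) has_derivative (\<lambda>h. h \<bullet> 0)) (at x)" by simp
  then have "(u has_derivative (\<lambda>h. h \<bullet> 0)) (at x)"
  proof (rule has_derivative_transform_within_open[OF _ _ x])
    show "open (- ?S)" by (intro open_Compl closed_closure)
    show "0 = u y" if "y \<in> - ?S" for y using zero[OF that] by (rule sym)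
  qed
  then have "GDERIV u x :> 0" by (simp add: gderiv_def)
  then show "grad u x = 0"
    unfolding grad_def by (intro the_equality) (auto intro: GDERIV_unique)
qed

context dyadic_tree
begin

text \<open>
  The constant in \<open>cond_upto_root_le\<close>.
\<close>

definition energy_const :: real where
  "energy_const = (2 * jump_const) powr p * (2 powr p * (2 / (p - 1) * young_const p) + 1)"

lemma energy_const_pos: "0 < energy_const"
proof -
  have "0 \<le> 2 powr p * (2 / (p - 1) * young_const p)"
    using p_gt_1 by (simp add: young_const_def)
  then show ?thesis
    using jump_const_pos by (simp add: energy_const_def add_nonneg_pos)
qed

text \<open>
  Every truncated conductance only sees a compact union of leaves, so that each of them is bounded
  by the capacity of a compact subset of \<open>G\<close>. The child cube in the corner lies
  outside \<open>\<Omega>\<close>, where test functions vanish.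
\<close>

lemma cond_le_capacity:
  assumes cap: "\<And>K. compact K \<Longrightarrow> K \<subseteq> G \<Longrightarrow> cap_compact p K \<Omega> \<le> ennreal \<kappa>"
    and \<Omega>: "open \<Omega>" "\<And>x. x \<in> cube (a0 + (l0 / 2) *\<^sub>R One) (l0 / 2) \<Longrightarrow> x \<notin> \<Omega>"
    and \<kappa>: "0 \<le> \<kappa>"
  shows "cond [] \<le> energy_const * \<kappa>"
proof (rule cond_le)
  fix N
  define K where "K = \<Union> (Q ` {v. set v \<subseteq> digits \<and> length v \<le> N \<and> Q v \<subseteq> G})"
  have "finite {v. set v \<subseteq> digits \<and> length v \<le> N \<and> Q v \<subseteq> G}"
    by (rule finite_subset[OF _ finite_lists_length_le[OF finite_digits, of N]]) auto
  then have K: "compact K" "K \<subseteq> G"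
    unfolding K_def by (auto intro!: compact_UN simp: Q_def compact_cube)
  have "ennreal (cond_upto N [] / energy_const) \<le> cap_compact p K \<Omega>"
    unfolding cap_compact_def
  proof (rule INF_greatest)
    fix u :: "'a \<Rightarrow> real" assume "u \<in> {u. test_function \<Omega> u \<and> (\<forall>x\<in>K. 1 \<le> u x)}"
    then have u: "test_function \<Omega> u" "\<And>x. x \<in> K \<Longrightarrow> 1 \<le> u x" by auto
    let ?f = "\<lambda>x. norm (grad u x) powr p"
    have cont: "continuous_on UNIV (grad u)"
      by (rule test_function_continuous_grad[OF u(1)])
    have contf: "continuous_on UNIV ?f"
      using cont p_gt_1 by (intro continuous_on_powr' continuous_intros) auto
    have int: "?f integrable_on Q []"
      unfolding Q_def cube_def using continuous_on_subset[OF contf] by (intro integrable_continuous) auto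
    have "cond_upto N [] \<le> energy_const * integral (Q []) ?f"
      unfolding energy_const_def
    proof (rule cond_upto_root_le[OF test_function_derivative[OF u(1)] cont])
      show "1 \<le> u x" if "set v \<subseteq> digits" "length v \<le> N" "Q v \<subseteq> G" "x \<in> Q v" for v x
        using that by (intro u(2)) (auto simp: K_def)
      show "u x = 0" if "x \<in> cube (a0 + (l0 / 2) *\<^sub>R One) (l0 / 2)" for x
        using test_function_outside(1)[OF u(1) \<Omega>(2)[OF that]] .
    qed (rule One_in_vertices)
    then have "cond_upto N [] / energy_const \<le> integral (Q []) ?f"
      using energy_const_pos by (simp add: field_simps)
    then have "ennreal (cond_upto N [] / energy_const) \<le> ennreal (integral (Q []) ?f)"
      by (rule ennreal_leI)
    also have "\<dots> = (\<integral>\<^sup>+x. indicator (Q []) x * ?f x \<partial>lborel)"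
      using nn_integral_has_integral_lebesgue[OF _ integrable_integral[OF int]] by simp
    also have "\<dots> \<le> (\<integral>\<^sup>+x\<in>\<Omega>. ennreal (?f x) \<partial>lborel)"
    proof (rule nn_integral_mono)
      fix x
      show "ennreal (indicator (Q []) x * ?f x) \<le> ennreal (?f x) * indicator \<Omega> x"
        using test_function_outside(2)[OF u(1), of x] p_gt_1
        by (cases "x \<in> \<Omega>") (auto simp: indicator_def)
    qed
    finally show "ennreal (cond_upto N [] / energy_const) \<le> (\<integral>\<^sup>+x\<in>\<Omega>. ennreal (?f x) \<partial>lborel)" .
  qed
  also have "\<dots> \<le> ennreal \<kappa>" by (rule cap[OF K])
  finally have "cond_upto N [] / energy_const \<le> \<kappa>"
    using \<kappa> by (simp add: ennreal_le_iff)
  then show "cond_upto N [] \<le> energy_const * \<kappa>"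
    using energy_const_pos by (simp add: field_simps)
qed

end

lemma two_powi_neg: "2 powi (- int i) = (1 / 2 :: real) ^ i"
  by (simp add: power_int_minus power_one_over inverse_eq_divide)

lemma two_powi_neg_plus_1: "2 powi (- int i + 1) = 2 * (1 / 2 :: real) ^ i"
  by (subst power_int_add) (simp_all add: two_powi_neg)

lemma annulus_bounds:
  fixes x :: "'a::euclidean_space"
  shows "x \<in> annulus_in 0 i \<longleftrightarrow> (1 / 2) ^ (i + 1) \<le> norm x \<and> norm x \<le> (1 / 2) ^ i"
    and "interior (annulus_out (0::'a) i) \<subseteq> ball 0 (2 * (1 / 2) ^ i)"
proof -
  have pw1: "2 powi (- int i - 1) = (1 / 2 :: real) ^ (i + 1)"
    by (simp add: power_int_diff two_powi_neg)
  show "x \<in> annulus_in 0 i \<longleftrightarrow> (1 / 2) ^ (i + 1) \<le> norm x \<and> norm x \<le> (1 / 2) ^ i"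
    unfolding annulus_in_def two_powi_neg pw1 by simp
  have "interior (annulus_out (0::'a) i) \<subseteq> interior (cball 0 (2 * (1 / 2) ^ i))"
    unfolding annulus_out_def two_powi_neg_plus_1 by (intro interior_mono) auto
  then show "interior (annulus_out (0::'a) i) \<subseteq> ball 0 (2 * (1 / 2) ^ i)" by simp
qed

definition annulus_cap :: "real \<Rightarrow> 'a::euclidean_space set \<Rightarrow> nat \<Rightarrow> ennreal" where
  "annulus_cap p E i = cap p (E \<inter> annulus_in 0 i) (interior (annulus_out 0 i))"

text \<open>
  The bound is stated for every measure \<open>M\<close> that dominates a multiple of \<open>\<mu>\<close>, since the
  superposition of the measures of all annuli is such an \<open>M\<close> for each of them. The constants depend
  only on \<open>p\<close> and the dimension, and the radius up to which the Wolff potential is integrated is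
  the same for all annuli: the root cubes have side at most \<open>4\<close>, and a cube of side \<open>l\<close> contributes
  at radii below \<open>2 DIM('a) l\<close>.
\<close>

lemma ex_annulus_measure:
  assumes "1 < p" "p \<le> real DIM('a::euclidean_space)"
  shows "\<exists>C k. 0 < C \<and> 0 < k \<and> (\<forall>(E :: 'a set) i \<epsilon>. annulus_cap p E (Suc i) < \<infinity> \<longrightarrow> 0 < \<epsilon> \<longrightarrow>
    (\<exists>\<mu>. sets \<mu> = sets borel \<and> emeasure \<mu> UNIV \<le> ennreal (C * (enn2real (annulus_cap p E (Suc i)) + \<epsilon>)) \<and>
      (\<forall>c M x. 0 \<le> c \<longrightarrow> sets M = sets borel \<longrightarrow>
        (\<forall>A\<in>sets borel. ennreal c * emeasure \<mu> A \<le> emeasure M A) \<longrightarrow> x \<in> E \<inter> annulus_in 0 (Suc i) \<longrightarrow>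
        ennreal (k * c powr (1 / (p - 1))) \<le> wolff M p x (8 * real DIM('a)))))"
proof -
  define C where "C = (2 * (real DIM('a) * 2 ^ DIM('a))) powr p * (2 powr p * (2 / (p - 1) * young_const p) + 1)"
  define k where "k = (2 * real DIM('a)) powr (- (real DIM('a) - p) / (p - 1)) / 2"
  have main: "\<exists>\<mu>. sets \<mu> = sets borel \<and> emeasure \<mu> UNIV \<le> ennreal (C * (enn2real (annulus_cap p E (Suc i)) + \<epsilon>)) \<and>
      (\<forall>c M x. 0 \<le> c \<longrightarrow> sets M = sets borel \<longrightarrow>
        (\<forall>A\<in>sets borel. ennreal c * emeasure \<mu> A \<le> emeasure M A) \<longrightarrow> x \<in> E \<inter> annulus_in 0 (Suc i) \<longrightarrow>
        ennreal (k * c powr (1 / (p - 1))) \<le> wolff M p x (8 * real DIM('a)))"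
    if fin: "annulus_cap p E (Suc i) < \<infinity>" and \<epsilon>: "0 < \<epsilon>" for E :: "'a set" and i \<epsilon>
  proof -
    define \<Omega> where "\<Omega> = interior (annulus_out (0::'a) (Suc i))"
    define \<rho> :: real where "\<rho> = 2 * (1 / 2) ^ Suc i"
    have \<rho>: "0 < \<rho>" "\<rho> \<le> 1" by (auto simp: \<rho>_def power_le_one)
    define \<kappa> where "\<kappa> = enn2real (annulus_cap p E (Suc i))"
    have \<kappa>: "0 \<le> \<kappa>" "annulus_cap p E (Suc i) = ennreal \<kappa>"
      using fin by (auto simp: \<kappa>_def)
    have "annulus_cap p E (Suc i) < ennreal (\<kappa> + \<epsilon>)"
      unfolding \<kappa>(2) using \<kappa>(1) \<epsilon> by (intro ennreal_lessI) auto
    then obtain G where G: "open G" "E \<inter> annulus_in 0 (Suc i) \<subseteq> G" "G \<subseteq> \<Omega>"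
      "(SUP K \<in> {K. compact K \<and> K \<subseteq> G}. cap_compact p K \<Omega>) < ennreal (\<kappa> + \<epsilon>)"
      unfolding annulus_cap_def cap_def \<Omega>_def by (auto simp: INF_less_iff)
    \<comment> \<open>The root cube contains the ball of radius \<open>\<rho>\<close> about the origin, in which \<open>\<Omega>\<close> lies, and
      its uppermost child touches that ball at most from outside.\<close>
    interpret T: dyadic_tree p "(- \<rho>) *\<^sub>R One :: 'a" "4 * \<rho>" G
      using assms \<rho> by unfold_locales auto
    have "T.cond [] \<le> T.energy_const * (\<kappa> + \<epsilon>)"
    proof (rule T.cond_le_capacity)
      show "cap_compact p K \<Omega> \<le> ennreal (\<kappa> + \<epsilon>)" if "compact K" "K \<subseteq> G" for K
        using that by (intro order_trans[OF SUP_upper less_imp_le[OF G(4)]]) auto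
      fix x :: 'a
      assume x: "x \<in> cube ((- \<rho>) *\<^sub>R One + (4 * \<rho> / 2) *\<^sub>R One) (4 * \<rho> / 2)"
      obtain b :: 'a where b: "b \<in> Basis" using nonempty_Basis by blast
      have "(- \<rho>) *\<^sub>R One + (4 * \<rho> / 2) *\<^sub>R One = \<rho> *\<^sub>R (One :: 'a)"
        by (simp only: scaleR_add_left[symmetric]) simp
      then have "\<forall>b\<in>Basis. (\<rho> *\<^sub>R One) \<bullet> b \<le> x \<bullet> b"
        using x unfolding mem_cube by simp
      then have "\<rho> \<le> x \<bullet> b" using b by simp
      also have "\<dots> \<le> norm x" using Basis_le_norm[OF b, of x] by simp
      finally show "x \<notin> \<Omega>"
        using annulus_bounds(2)[of "Suc i"] by (auto simp: \<Omega>_def \<rho>_def)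
    qed (use \<kappa> \<epsilon> in \<open>auto simp: \<Omega>_def\<close>)
    also have "T.energy_const = C"
      by (simp add: T.energy_const_def C_def T.jump_const_def)
    finally have cond: "T.cond [] \<le> C * (\<kappa> + \<epsilon>)" .
    obtain \<mu> where \<mu>: "sets \<mu> = sets borel" "emeasure \<mu> UNIV = ennreal (T.cond [])"
      "\<And>v. set v \<subseteq> T.digits \<Longrightarrow> ennreal (T.mass v) \<le> emeasure \<mu> (T.Q v)"
      using T.ex_equilibrium_measure by blast
    have W: "ennreal (k * c powr (1 / (p - 1))) \<le> wolff M p x (8 * real DIM('a))"
      if c: "0 \<le> c" and M: "sets M = sets borel"
        and le: "\<forall>A\<in>sets borel. ennreal c * emeasure \<mu> A \<le> emeasure M A"
        and x: "x \<in> E \<inter> annulus_in 0 (Suc i)" for c M x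
    proof -
      have "ennreal (T.wolff_const * c powr (1 / (p - 1))) \<le> wolff M p x (8 * real DIM('a))"
      proof (rule T.wolff_ge_on_leaves[OF assms(2) c M _ _ G(1)])
        show "ennreal (c * T.mass v) \<le> emeasure M (T.Q v)" if "set v \<subseteq> T.digits" for v
        proof -
          have "ennreal (c * T.mass v) = ennreal c * ennreal (T.mass v)"
            using c T.mass_nonneg by (simp add: ennreal_mult)
          also have "\<dots> \<le> ennreal c * emeasure \<mu> (T.Q v)"
            by (intro mult_left_mono \<mu>(3) that) auto
          also have "\<dots> \<le> emeasure M (T.Q v)"
            unfolding T.Q_def cube_def by (intro le[rule_format]) simp
          finally show ?thesis .
        qed
        have "2 * real DIM('a) * (4 * \<rho>) \<le> 2 * real DIM('a) * (4 * 1)"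
          using \<rho> by (intro mult_left_mono) auto
        then show "2 * real DIM('a) * (4 * \<rho>) \<le> 8 * real DIM('a)" by simp
        show "x \<in> G" using x G(2) by blast
        have nx: "norm x \<le> \<rho>"
        proof -
          have "norm x \<le> (1 / 2) ^ Suc i" using x annulus_bounds(1)[of x "Suc i"] by auto
          also have "\<dots> \<le> \<rho>" by (simp add: \<rho>_def)
          finally show ?thesis .
        qed
        show "x \<in> T.Q []"
          unfolding T.Q_def mem_cube
        proof
          fix b :: 'a assume b: "b \<in> Basis"
          have "\<bar>x \<bullet> b\<bar> \<le> \<rho>" using Basis_le_norm[OF b, of x] nx by linarith
          moreover have "T.corner [] \<bullet> b = - \<rho>" unfolding T.corner.simps using b by simp
          moreover have "T.side [] = 4 * \<rho>" by (simp add: T.side_def)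
          ultimately show "T.corner [] \<bullet> b \<le> x \<bullet> b \<and> x \<bullet> b \<le> T.corner [] \<bullet> b + T.side []"
            by linarith
        qed
      qed
      then show ?thesis by (simp add: T.wolff_const_def k_def)
    qed
    show ?thesis
      using \<mu> cond W by (intro exI[of _ \<mu>]) (auto simp: \<kappa>_def intro!: ennreal_leI)
  qed
  have "0 \<le> 2 powr p * (2 / (p - 1) * young_const p)"
    using assms by (simp add: young_const_def)
  then have "0 < C" by (simp add: C_def add_nonneg_pos)
  moreover have "0 < k" by (simp add: k_def)
  ultimately show ?thesis using main by blast
qed

section \<open>Superposition over the annuli\<close>

text \<open>
  The error terms are chosen so that they add \<open>2\<^bsup>-i\<^esup>\<close> to the \<open>i\<close>-th weighted capacity: this
  keeps the series convergent and makes its terms positive, as \<open>ex_divergent_weights\<close> requires.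
\<close>

lemma ex_superposed_measure:
  fixes E :: "'a::euclidean_space set" and q :: "nat \<Rightarrow> real"
  assumes p: "1 < p" "p \<le> real DIM('a)"
    and q: "\<And>i. 0 < q i"
    and fin: "(\<Sum>i. ennreal (q i) * annulus_cap p E (Suc i)) < \<infinity>"
  shows "\<exists>M \<beta> k. sets M = sets borel \<and> emeasure M UNIV < \<infinity> \<and> 0 < k \<and> filterlim \<beta> at_top sequentially \<and>
    (\<forall>i x. x \<in> E \<inter> annulus_in 0 (Suc i) \<longrightarrow>
      ennreal (k * q i powr (1 / (p - 1)) * \<beta> i) \<le> wolff M p x (8 * real DIM('a)))"
proof -
  let ?cap = "\<lambda>i. annulus_cap p E (Suc i)"
  obtain C k where C: "0 < C" "0 < k" and annulus: "\<forall>(E :: 'a set) i \<epsilon>. annulus_cap p E (Suc i) < \<infinity> \<longrightarrow> 0 < \<epsilon> \<longrightarrow>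
    (\<exists>\<mu>. sets \<mu> = sets borel \<and> emeasure \<mu> UNIV \<le> ennreal (C * (enn2real (annulus_cap p E (Suc i)) + \<epsilon>)) \<and>
      (\<forall>c M x. 0 \<le> c \<longrightarrow> sets M = sets borel \<longrightarrow>
        (\<forall>A\<in>sets borel. ennreal c * emeasure \<mu> A \<le> emeasure M A) \<longrightarrow> x \<in> E \<inter> annulus_in 0 (Suc i) \<longrightarrow>
        ennreal (k * c powr (1 / (p - 1))) \<le> wolff M p x (8 * real DIM('a))))"
    using ex_annulus_measure[OF p] by blast
  have cap_fin: "?cap i < \<infinity>" for i
  proof -
    have "ennreal (q i) * ?cap i < \<infinity>"
      by (rule ennreal_suminf_lessD[OF fin])
    then show ?thesis using q[of i] by (auto simp: ennreal_mult_less_top)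
  qed
  define \<kappa> where "\<kappa> i = enn2real (?cap i)" for i
  have \<kappa>: "0 \<le> \<kappa> i" "?cap i = ennreal (\<kappa> i)" for i
    using cap_fin[of i] by (auto simp: \<kappa>_def)
  have qk: "ennreal (q i) * ?cap i = ennreal (q i * \<kappa> i)" for i
    using \<kappa>(1)[of i] q[of i] unfolding \<kappa>(2) by (simp add: ennreal_mult less_imp_le)
  have "summable (\<lambda>i. q i * \<kappa> i)"
    by (rule summable_suminf_not_top) (use fin \<kappa>(1) q in \<open>auto simp: qk less_imp_le\<close>)
  moreover have "summable (\<lambda>i. (1 / 2 :: real) ^ i)" by simp
  ultimately have sb: "summable (\<lambda>i. q i * \<kappa> i + (1 / 2) ^ i)"
    by (rule summable_add)
  moreover have "0 < q i * \<kappa> i + (1 / 2) ^ i" for i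
    using \<kappa>(1)[of i] q[of i] by (intro add_nonneg_pos) auto
  ultimately obtain \<gamma> where \<gamma>: "\<And>i. 0 < \<gamma> i" "filterlim \<gamma> at_top sequentially"
    "summable (\<lambda>i. \<gamma> i * (q i * \<kappa> i + (1 / 2) ^ i))"
    using ex_divergent_weights[of "\<lambda>i. q i * \<kappa> i + (1 / 2) ^ i"] by blast
  define \<epsilon> where "\<epsilon> i = (1 / 2) ^ i / q i" for i
  have \<epsilon>: "0 < \<epsilon> i" "q i * \<epsilon> i = (1 / 2) ^ i" for i using q[of i] by (auto simp: \<epsilon>_def)
  have "\<exists>\<mu>. sets \<mu> = sets borel \<and> emeasure \<mu> UNIV \<le> ennreal (C * (\<kappa> i + \<epsilon> i)) \<and>
      (\<forall>c M x. 0 \<le> c \<longrightarrow> sets M = sets borel \<longrightarrow>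
        (\<forall>A\<in>sets borel. ennreal c * emeasure \<mu> A \<le> emeasure M A) \<longrightarrow> x \<in> E \<inter> annulus_in 0 (Suc i) \<longrightarrow>
        ennreal (k * c powr (1 / (p - 1))) \<le> wolff M p x (8 * real DIM('a)))" for i
    unfolding \<kappa>_def using annulus cap_fin[of i] \<epsilon>(1)[of i] by blast
  then obtain \<mu> where \<mu>: "\<And>i. sets (\<mu> i) = sets borel"
    "\<And>i. emeasure (\<mu> i) UNIV \<le> ennreal (C * (\<kappa> i + \<epsilon> i))"
    "\<And>i c M x. 0 \<le> c \<Longrightarrow> sets M = sets borel \<Longrightarrow>
        (\<forall>A\<in>sets borel. ennreal c * emeasure (\<mu> i) A \<le> emeasure M A) \<Longrightarrow> x \<in> E \<inter> annulus_in 0 (Suc i) \<Longrightarrow>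
        ennreal (k * c powr (1 / (p - 1))) \<le> wolff M p x (8 * real DIM('a))"
    by metis
  obtain M where M: "sets M = sets borel"
    "\<And>A. A \<in> sets borel \<Longrightarrow> emeasure M A = (\<Sum>i. ennreal (q i * \<gamma> i) * emeasure (\<mu> i) A)"
    using ex_sum_measure[of \<mu> "\<lambda>i. ennreal (q i * \<gamma> i)"] \<mu>(1) by blast
  have UNIV_sets: "UNIV \<in> sets (borel :: 'a measure)" by simp
  have "emeasure M UNIV \<le> (\<Sum>i. ennreal (C * (\<gamma> i * (q i * \<kappa> i + (1 / 2) ^ i))))"
    unfolding M(2)[OF UNIV_sets]
  proof (intro suminf_le summableI)
    fix i
    have "ennreal (q i * \<gamma> i) * emeasure (\<mu> i) UNIV \<le> ennreal (q i * \<gamma> i) * ennreal (C * (\<kappa> i + \<epsilon> i))"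
      by (intro mult_left_mono \<mu>(2)) auto
    also have "\<dots> = ennreal (q i * \<gamma> i * (C * (\<kappa> i + \<epsilon> i)))"
      using q[of i] \<gamma>(1)[of i] by (intro ennreal_mult'[symmetric]) auto
    also have "q i * \<gamma> i * (C * (\<kappa> i + \<epsilon> i)) = C * (\<gamma> i * (q i * \<kappa> i + q i * \<epsilon> i))"
      by (simp add: algebra_simps)
    finally show "ennreal (q i * \<gamma> i) * emeasure (\<mu> i) UNIV
        \<le> ennreal (C * (\<gamma> i * (q i * \<kappa> i + (1 / 2) ^ i)))" by (simp add: \<epsilon>(2))
  qed
  also have "\<dots> < \<infinity>"
  proof -
    have "(\<Sum>i. ennreal (C * (\<gamma> i * (q i * \<kappa> i + (1 / 2) ^ i)))) \<noteq> top"
      using C(1) \<gamma>(1) q \<kappa>(1)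
      by (intro ennreal_suminf_neq_top summable_mult \<gamma>(3) mult_nonneg_nonneg add_nonneg_nonneg)
        (auto intro: less_imp_le)
    then show ?thesis by (simp add: less_top)
  qed
  finally have M_fin: "emeasure M UNIV < \<infinity>" .
  have W: "ennreal (k * q i powr (1 / (p - 1)) * \<gamma> i powr (1 / (p - 1))) \<le> wolff M p x (8 * real DIM('a))"
    if x: "x \<in> E \<inter> annulus_in 0 (Suc i)" for i x
  proof -
    have "ennreal (k * (q i * \<gamma> i) powr (1 / (p - 1))) \<le> wolff M p x (8 * real DIM('a))"
    proof (rule \<mu>(3)[OF _ M(1) _ x])
      show "0 \<le> q i * \<gamma> i" using q[of i] \<gamma>(1)[of i] by simp
      show "\<forall>A\<in>sets borel. ennreal (q i * \<gamma> i) * emeasure (\<mu> i) A \<le> emeasure M A"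
      proof
        fix A :: "'a set" assume A: "A \<in> sets borel"
        have "(\<Sum>j\<in>{i}. ennreal (q j * \<gamma> j) * emeasure (\<mu> j) A)
            \<le> (\<Sum>j. ennreal (q j * \<gamma> j) * emeasure (\<mu> j) A)"
          by (rule sum_le_suminf) auto
        then show "ennreal (q i * \<gamma> i) * emeasure (\<mu> i) A \<le> emeasure M A"
          by (simp add: M(2)[OF A])
      qed
    qed
    then show ?thesis by (simp only: powr_mult mult.assoc)
  qed
  have "filterlim (\<lambda>i. \<gamma> i powr (1 / (p - 1))) at_top sequentially"
  proof -
    have "\<gamma> i powr (1 / (p - 1)) = exp (1 / (p - 1) * ln (\<gamma> i))" for i
      using \<gamma>(1)[of i] by (simp add: powr_def)
    moreover have "filterlim (\<lambda>i. exp (1 / (p - 1) * ln (\<gamma> i))) at_top sequentially"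
      by (rule filterlim_compose[OF exp_at_top filterlim_tendsto_pos_mult_at_top[OF
            tendsto_const _ filterlim_compose[OF ln_at_top \<gamma>(2)]]]) (use p in auto)
    ultimately show ?thesis by simp
  qed
  then show ?thesis
    using M(1) M_fin C(2) W by (intro exI[of _ M] exI[of _ "\<lambda>i. \<gamma> i powr (1 / (p - 1))"] exI[of _ k]) auto
qed

lemma radon_measure_on_finite:
  fixes M :: "'a::euclidean_space measure"
  assumes "sets M = sets borel" "emeasure M UNIV < \<infinity>"
  shows "radon_measure_on UNIV M"
proof -
  have sp: "space M = UNIV" using sets_eq_imp_space_eq[OF assms(1)] by simp
  have "emeasure M A = (SUP K \<in> {K. compact K \<and> K \<subseteq> A}. emeasure M K)" if "A \<in> sets M" for A
    using inner_regular[OF assms(1), of A] that assms sp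
    by (simp add: conj_commute less_top[symmetric])
  moreover have "emeasure M K < \<infinity>" if "compact K" for K
  proof -
    have "emeasure M K \<le> emeasure M UNIV"
      by (rule emeasure_mono) (auto simp: assms(1))
    then show ?thesis using assms(2) by (rule le_less_trans)
  qed
  ultimately show ?thesis
    using assms(1) by (simp add: radon_measure_on_def)
qed

lemma ex_annulus:
  fixes x :: "'a::euclidean_space"
  assumes "x \<noteq> 0" "norm x < (1 / 2) ^ Suc J"
  shows "\<exists>i\<ge>J. x \<in> annulus_in 0 (Suc i)"
proof -
  have lim: "(\<lambda>i. (1 / 2 :: real) ^ i) \<longlonglongrightarrow> 0" by (rule LIMSEQ_power_zero) simp
  have "eventually (\<lambda>i. (1 / 2 :: real) ^ i < norm x) sequentially"
    by (rule order_tendstoD(2)[OF lim]) (use assms in simp)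
  then have ex: "\<exists>i. (1 / 2 :: real) ^ i < norm x"
    using eventually_happens'[OF sequentially_bot] by blast
  define m where "m = (LEAST i. (1 / 2 :: real) ^ i < norm x)"
  have m: "(1 / 2) ^ m < norm x" unfolding m_def by (rule LeastI_ex[OF ex])
  have "Suc J < m"
  proof (rule ccontr)
    assume "\<not> Suc J < m"
    then have "(1 / 2 :: real) ^ Suc J \<le> (1 / 2) ^ m" by (intro power_decreasing) auto
    with m assms show False by simp
  qed
  then obtain i where i: "m = Suc (Suc i)" "J \<le> i"
    by (metis Suc_le_D Suc_le_mono less_eq_Suc_le)
  have "\<not> (1 / 2 :: real) ^ Suc i < norm x"
    using not_less_Least[of "Suc i" "\<lambda>i. (1 / 2 :: real) ^ i < norm x"] i by (simp add: m_def)
  then have "x \<in> annulus_in 0 (Suc i)"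
    using m i by (auto simp: annulus_bounds(1))
  with i show ?thesis by blast
qed

lemma tendsto_infinity_on_annuli:
  fixes E :: "'a::euclidean_space set" and f :: "'a \<Rightarrow> ennreal"
  assumes \<beta>: "filterlim \<beta> at_top sequentially" and k: "0 < k"
    and f: "\<And>i x. x \<in> E \<inter> annulus_in 0 (Suc i) \<Longrightarrow> ennreal (k * \<beta> i) \<le> f x"
  shows "(f \<longlongrightarrow> \<infinity>) (at 0 within E)"
proof (rule order_tendstoI)
  fix a :: ennreal assume "a < \<infinity>"
  then obtain r where r: "a = ennreal r" "0 \<le> r" by (cases a) auto
  have "eventually (\<lambda>i. r / k < \<beta> i) sequentially"
    using \<beta> by (simp add: filterlim_at_top_dense)
  then obtain J where J: "\<And>i. J \<le> i \<Longrightarrow> r / k < \<beta> i"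
    by (auto simp: eventually_sequentially)
  show "eventually (\<lambda>x. a < f x) (at 0 within E)"
    unfolding eventually_at
  proof (intro exI[of _ "(1 / 2) ^ Suc J"] conjI ballI impI)
    fix x assume x: "x \<in> E" "x \<noteq> 0 \<and> dist x 0 < (1 / 2) ^ Suc J"
    then obtain i where i: "J \<le> i" "x \<in> annulus_in 0 (Suc i)"
      using ex_annulus[of x J] by auto
    have "r < k * \<beta> i" using J[OF i(1)] k by (simp add: field_simps)
    then have "a < ennreal (k * \<beta> i)" using r by (simp add: ennreal_lessI)
    also have "\<dots> \<le> f x" using f x i by blast
    finally show "a < f x" .
  qed simp
qed simp

text \<open>
  An upper bound for the capacities of the spheres bounds the quotients in the definition of
  thinness from below.
\<close>

lemma thin_singular_weighted:
  fixes E :: "'a::euclidean_space set"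
  assumes "1 < p" "p < real DIM('a)" "thin_singular p E 0"
  shows "(\<Sum>i. ennreal ((2 ^ Suc i) powr (real DIM('a) - p)) * annulus_cap p E (Suc i)) < \<infinity>"
proof -
  let ?C = "sphere_cap_const DIM('a) p"
  let ?q = "\<lambda>i. (2 ^ Suc i) powr (real DIM('a) - p)"
  let ?den = "\<lambda>i. cap p (sphere (0::'a) (2 powi (- int (Suc i)))) (ball 0 (2 powi (- int (Suc i) + 1)))"
  have C: "0 < ?C" by (simp add: sphere_cap_const_def unit_ball_vol_pos)
  have bound: "ennreal (?q i) * annulus_cap p E (Suc i) \<le> ennreal ?C * (annulus_cap p E (Suc i) / ?den i)" for i
  proof -
    define \<rho> :: real where "\<rho> = (1 / 2) ^ Suc i"
    have \<rho>: "0 < \<rho>" by (simp add: \<rho>_def)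
    have "?den i \<le> ennreal (?C * \<rho> powr (real DIM('a) - p))"
      unfolding two_powi_neg two_powi_neg_plus_1 \<rho>_def[symmetric] by (rule cap_sphere_le[OF \<rho> assms(1)])
    then have "inverse (ennreal (?C * \<rho> powr (real DIM('a) - p))) \<le> inverse (?den i)"
      by (rule inverse_antimono_ennreal)
    then have "ennreal (inverse (?C * \<rho> powr (real DIM('a) - p))) \<le> inverse (?den i)"
      using C \<rho> by (subst (asm) inverse_ennreal) auto
    then have "ennreal ?C * ennreal (inverse (?C * \<rho> powr (real DIM('a) - p))) \<le> ennreal ?C * inverse (?den i)"
      by (intro mult_left_mono) auto
    moreover have "ennreal ?C * ennreal (inverse (?C * \<rho> powr (real DIM('a) - p)))
        = ennreal (?C * inverse (?C * \<rho> powr (real DIM('a) - p)))"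
      using C by (intro ennreal_mult'[symmetric]) auto
    moreover have "?C * inverse (?C * \<rho> powr (real DIM('a) - p)) = ?q i"
    proof -
      have "?C * inverse (?C * \<rho> powr (real DIM('a) - p)) = inverse (\<rho> powr (real DIM('a) - p))"
        using C by (simp add: field_simps)
      also have "\<dots> = inverse \<rho> powr (real DIM('a) - p)"
        by (simp add: inverse_powr)
      also have "inverse \<rho> = 2 ^ Suc i"
        by (simp add: \<rho>_def power_one_over inverse_eq_divide)
      finally show ?thesis .
    qed
    ultimately have "ennreal (?q i) \<le> ennreal ?C * inverse (?den i)" by simp
    then have "ennreal (?q i) * annulus_cap p E (Suc i) \<le> ennreal ?C * inverse (?den i) * annulus_cap p E (Suc i)"
      by (intro mult_right_mono) auto
    then show ?thesis by (simp add: divide_ennreal_def mult_ac)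
  qed
  have "(\<Sum>i. ennreal (?q i) * annulus_cap p E (Suc i))
      \<le> (\<Sum>i. ennreal ?C * (annulus_cap p E (Suc i) / ?den i))"
    by (intro suminf_le summableI bound)
  also have "\<dots> = ennreal ?C * (\<Sum>i. annulus_cap p E (Suc i) / ?den i)"
    by (rule ennreal_suminf_cmult)
  also have "\<dots> < \<infinity>"
  proof -
    have "(\<Sum>i. annulus_cap p E (Suc i) / ?den i) < \<infinity>"
      using assms(2,3) unfolding thin_singular_def annulus_cap_def Let_def by (simp only: if_True)
    then show ?thesis by (simp add: ennreal_mult_less_top)
  qed
  finally show ?thesis .
qed

theorem theorem2:
  fixes E :: "'a::euclidean_space set" and p :: real
  assumes "DIM('a) \<ge> 2"
    and "1 < p" and "p \<le> real DIM('a)"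
    and "thin_singular p E 0"
    and "0 \<in> closure E - E"
  shows "(p < real DIM('a) \<longrightarrow>
           (\<exists>U \<mu> r0. open U \<and> 0 \<in> U \<and> radon_measure_on U \<mu> \<and> r0 > 0 \<and> cball 0 r0 \<subseteq> U \<and>
              ((\<lambda>x. ennreal (norm x powr ((real DIM('a) - p) / (p - 1))) * wolff \<mu> p x r0)
                 \<longlongrightarrow> \<infinity>) (at 0 within E))) \<and>
         (p = real DIM('a) \<longrightarrow>
           (\<exists>U \<mu> r0. open U \<and> 0 \<in> U \<and> radon_measure_on U \<mu> \<and> r0 > 0 \<and> cball 0 r0 \<subseteq> U \<and>
              ((\<lambda>x. wolff \<mu> p x r0 / ennreal (ln (1 / norm x))) \<longlongrightarrow> \<infinity>) (at 0 within E)))"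
proof (intro conjI impI)
  let ?r0 = "8 * real DIM('a)"
  assume lt: "p < real DIM('a)"
  define q where "q i = (2 ^ Suc i) powr (real DIM('a) - p)" for i :: nat
  define e where "e = (real DIM('a) - p) / (p - 1)"
  have e: "0 \<le> e" using lt assms(2) by (simp add: e_def)
  have "0 < q i" for i by (simp add: q_def)
  moreover have "(\<Sum>i. ennreal (q i) * annulus_cap p E (Suc i)) < \<infinity>"
    unfolding q_def by (rule thin_singular_weighted[OF assms(2) lt assms(4)])
  ultimately obtain M \<beta> k where M: "sets M = sets borel" "emeasure M UNIV < \<infinity>" "0 < k"
    "filterlim \<beta> at_top sequentially"
    "\<And>i x. x \<in> E \<inter> annulus_in 0 (Suc i) \<Longrightarrow>
      ennreal (k * q i powr (1 / (p - 1)) * \<beta> i) \<le> wolff M p x ?r0"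
    using ex_superposed_measure[OF assms(2,3), of q E] by blast
  have "((\<lambda>x. ennreal (norm x powr e) * wolff M p x ?r0) \<longlongrightarrow> \<infinity>) (at 0 within E)"
  proof (rule tendsto_infinity_on_annuli[OF M(4)])
    show "0 < k * (1 / 2) powr e" using M(3) by simp
    fix i x assume x: "x \<in> E \<inter> annulus_in 0 (Suc i)"
    have "(1 / 2) ^ Suc i * (1 / 2) \<le> norm x"
      using x by (simp add: annulus_bounds(1))
    then have "((1 / 2) ^ Suc i * (1 / 2)) powr e \<le> norm x powr e"
      using e by (intro powr_mono2) auto
    then have "ennreal (((1 / 2) ^ Suc i) powr e * (1 / 2) powr e) \<le> ennreal (norm x powr e)"
      by (intro ennreal_leI) (simp only: powr_mult)
    then have "ennreal (((1 / 2) ^ Suc i) powr e * (1 / 2) powr e) * ennreal (k * q i powr (1 / (p - 1)) * \<beta> i)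
        \<le> ennreal (norm x powr e) * wolff M p x ?r0"
      using M(5)[OF x] by (intro mult_mono) auto
    also have "ennreal (((1 / 2) ^ Suc i) powr e * (1 / 2) powr e) * ennreal (k * q i powr (1 / (p - 1)) * \<beta> i)
        = ennreal ((((1 / 2) ^ Suc i) powr e * (1 / 2) powr e) * (k * q i powr (1 / (p - 1)) * \<beta> i))"
      by (intro ennreal_mult'[symmetric]) auto
    also have "(((1 / 2) ^ Suc i) powr e * (1 / 2) powr e) * (k * q i powr (1 / (p - 1)) * \<beta> i)
        = (((1 / 2) ^ Suc i) powr e * q i powr (1 / (p - 1))) * (k * (1 / 2) powr e * \<beta> i)"
      by (simp only: mult_ac)
    also have "((1 / 2) ^ Suc i) powr e * q i powr (1 / (p - 1)) = 1"
    proof -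
      have "q i powr (1 / (p - 1)) = (2 ^ Suc i) powr e"
        by (simp add: q_def e_def powr_powr)
      then have "((1 / 2) ^ Suc i) powr e * q i powr (1 / (p - 1)) = ((1 / 2) ^ Suc i * 2 ^ Suc i) powr e"
        by (simp only: powr_mult)
      also have "(1 / 2 :: real) ^ Suc i * 2 ^ Suc i = 1"
        by (simp only: power_mult_distrib[symmetric]) simp
      finally show ?thesis by simp
    qed
    finally show "ennreal (k * (1 / 2) powr e * \<beta> i) \<le> ennreal (norm x powr e) * wolff M p x ?r0" by simp
  qed
  then show "\<exists>U \<mu> r0. open U \<and> 0 \<in> U \<and> radon_measure_on U \<mu> \<and> r0 > 0 \<and> cball 0 r0 \<subseteq> U \<and>
      ((\<lambda>x. ennreal (norm x powr ((real DIM('a) - p) / (p - 1))) * wolff \<mu> p x r0) \<longlongrightarrow> \<infinity>) (at 0 within E)"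
    using radon_measure_on_finite[OF M(1,2)]
    by (intro exI[of _ UNIV] exI[of _ M] exI[of _ ?r0]) (auto simp: e_def)
next
  let ?r0 = "8 * real DIM('a)"
  assume eq: "p = real DIM('a)"
  define q where "q i = real (Suc i ^ (DIM('a) - 1))" for i
  have "0 < q i" for i by (simp add: q_def)
  moreover have "(\<Sum>i. ennreal (q i) * annulus_cap p E (Suc i)) < \<infinity>"
    using assms(4) eq unfolding thin_singular_def annulus_cap_def Let_def q_def
    by (simp add: ennreal_of_nat_eq_real_of_nat)
  ultimately obtain M \<beta> k where M: "sets M = sets borel" "emeasure M UNIV < \<infinity>" "0 < k"
    "filterlim \<beta> at_top sequentially"
    "\<And>i x. x \<in> E \<inter> annulus_in 0 (Suc i) \<Longrightarrow>
      ennreal (k * q i powr (1 / (p - 1)) * \<beta> i) \<le> wolff M p x ?r0"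
    using ex_superposed_measure[OF assms(2,3), of q E] by blast
  have qp: "q i powr (1 / (p - 1)) = real (Suc i)" for i
  proof -
    have "q i = real (Suc i) powr (p - 1)"
      using assms(1) powr_realpow[of "real (Suc i)" "DIM('a) - 1"] by (simp add: q_def eq of_nat_diff)
    then show ?thesis using assms(2) by (simp add: powr_powr)
  qed
  have "((\<lambda>x. wolff M p x ?r0 / ennreal (ln (1 / norm x))) \<longlongrightarrow> \<infinity>) (at 0 within E)"
  proof (rule tendsto_infinity_on_annuli[OF M(4)])
    show "0 < k / 2" using M(3) by simp
    fix i x assume x: "x \<in> E \<inter> annulus_in 0 (Suc i)"
    have nx: "(1 / 2) ^ (i + 2) \<le> norm x" "0 < norm x"
      using x less_le_trans[of 0 "(1 / 2 :: real) ^ (i + 2)" "norm x"] by (auto simp: annulus_bounds(1))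
    have "1 / norm x \<le> 2 ^ (i + 2)"
      using nx by (simp add: field_simps power_divide)
    then have "ln (1 / norm x) \<le> ln (2 ^ (i + 2))"
      using nx by (subst ln_le_cancel_iff) auto
    also have "\<dots> = real (i + 2) * ln 2" by (rule ln_realpow)
    also have "\<dots> \<le> real (i + 2) * 1" using ln_2_less_1 by (intro mult_left_mono) auto
    also have "\<dots> \<le> 2 * real (Suc i)" by simp
    finally have "inverse (ennreal (2 * real (Suc i))) \<le> inverse (ennreal (ln (1 / norm x)))"
      by (intro inverse_antimono_ennreal ennreal_leI)
    then have "ennreal (inverse (2 * real (Suc i))) \<le> inverse (ennreal (ln (1 / norm x)))"
      by (subst (asm) inverse_ennreal) auto
    then have "ennreal (k * real (Suc i) * \<beta> i) * ennreal (inverse (2 * real (Suc i)))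
        \<le> wolff M p x ?r0 / ennreal (ln (1 / norm x))"
      unfolding divide_ennreal_def using M(5)[OF x] by (intro mult_mono) (auto simp: qp)
    also have "ennreal (k * real (Suc i) * \<beta> i) * ennreal (inverse (2 * real (Suc i)))
        = ennreal (k * real (Suc i) * \<beta> i * inverse (2 * real (Suc i)))"
      by (intro ennreal_mult''[symmetric]) auto
    also have "k * real (Suc i) * \<beta> i * inverse (2 * real (Suc i)) = k / 2 * \<beta> i"
      by (simp add: field_simps del: of_nat_Suc)
    finally show "ennreal (k / 2 * \<beta> i) \<le> wolff M p x ?r0 / ennreal (ln (1 / norm x))" .
  qed
  then show "\<exists>U \<mu> r0. open U \<and> 0 \<in> U \<and> radon_measure_on U \<mu> \<and> r0 > 0 \<and> cball 0 r0 \<subseteq> U \<and>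
      ((\<lambda>x. wolff \<mu> p x r0 / ennreal (ln (1 / norm x))) \<longlongrightarrow> \<infinity>) (at 0 within E)"
    using radon_measure_on_finite[OF M(1,2)]
    by (intro exI[of _ UNIV] exI[of _ M] exI[of _ ?r0]) auto
qed

end
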